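(* Let $A$ be a Henselian local commutative ring with maximal ideal $\mathfrak{m}$, whose underlying abelian group is torsion-free. Suppose that $\mathfrak{m}$ can be generated by $\kappa$ elements, where $\kappa$ is some cardinal number. Then, for each positive integer $n$, the $A$-module $\overline{L}^A_{2n-2}$ can be generated by: \begin{itemize} \item $1+\kappa$ elements, if the residue field $A/\mathfrak{m}$ is isomorphic to a finite field $\mathbb{F}_q$ and $n$ is a power of $q$; \item $1$ element (i.e., $\overline{L}^A_{2n-2}$ is a cyclic $A$-module) otherwise. \end{itemize}
   Context: For a commutative ring $A$ and a commutative $A$-algebra $R$, a (one-dimensional) formal $A$-module over $R$ is a formal group law $F(X,Y)\in R[[X,Y]]$ together with a ring homomorphism $\rho: A\to \mathrm{End}(F)$ such that $\rho(a)(X)\equiv aX \bmod X^2$ for all $a\in A$; here $\mathrm{End}(F)\subseteq R[[X]]$ has addition $F(f(X),g(X))$ and multiplication given by composition. $L^A$ is the commutative $A$-algebra corepresenting the functor sending $R$ to the set of formal $A$-modules over $R$. It is graded, concentrated in even nonnegative degrees: if the universal formal $A$-module is $F(X,Y)=\sum \alpha_{i,j}X^iY^j$, $\rho(a)(X)=\sum_{i\ge 1} \rho_{a,i} X^i$, then $\alpha_{i,j}$ has degree $2(i+j-1)$ and $\rho_{a,i}$ has degree $2(i-1)$. Let $D^A\subseteq L^A$ be the homogeneous ideal generated by all products $xy$ with $x,y\in L^A$ homogeneous of positive degree, and let $\overline{L}^A=L^A/D^A$, with degree $m$ summand $\overline{L}^A_m$. It is known (Drinfeld) that for $n\ge 2$,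 $\overline{L}^A_{2n-2}$ is isomorphic to the $A$-module generated by symbols $\gamma$ and $\{c_a: a\in A\}$ modulo the relations, for all $a,b\in A$: $(a^n-a)\gamma=\nu(n)c_a$; $c_{a+b}-c_a-c_b=\gamma\,\frac{(a+b)^n-a^n-b^n}{\nu(n)}$; $ac_b+b^nc_a=c_{ab}$. Here $\nu(n)=p$ if $n$ is a power of a prime $p$, and $\nu(n)=1$ if $n$ is not a prime power. *)

theory Defs
  imports
    "HOL-Computational_Algebra.Polynomial"
    "HOL-Computational_Algebra.Formal_Power_Series"
    "HOL-Library.Poly_Mapping"
begin

unbundle fps_syntax and cardinal_syntax

section \<open>Ring homomorphisms and ideals\<close>

definition is_ring_hom :: "('r::comm_ring_1 \<Rightarrow> 's::comm_ring_1) \<Rightarrow> bool" where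
  "is_ring_hom h \<longleftrightarrow>
     h 1 = 1 \<and> (\<forall>x y. h (x + y) = h x + h y) \<and> (\<forall>x y. h (x * y) = h x * h y)"

text \<open>
  An ideal is a submodule of the ring, regarded as a module over itself, so the notions of
  \<^theory>\<open>HOL.Modules\<close> apply with the multiplication as scalar action.
\<close>

lemma module_times: "module ((*) :: 'r::comm_ring_1 \<Rightarrow> 'r \<Rightarrow> 'r)"
  by standard (simp_all add: algebra_simps)

abbreviation is_ideal :: "'r::comm_ring_1 set \<Rightarrow> bool" where
  "is_ideal \<equiv> module.subspace (*)"

abbreviation ideal_gen :: "'r::comm_ring_1 set \<Rightarrow> 'r set" where
  "ideal_gen \<equiv> module.span (*)"

definition maximal_ideal :: "'r::comm_ring_1 set \<Rightarrow> bool" where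
  "maximal_ideal M \<longleftrightarrow>
     is_ideal M \<and> M \<noteq> UNIV \<and> (\<forall>J. is_ideal J \<and> M \<subseteq> J \<longrightarrow> J = M \<or> J = UNIV)"

text \<open>The ring is local with (unique) maximal ideal \<open>M\<close>.\<close>

definition local_ring :: "'r::comm_ring_1 set \<Rightarrow> bool" where
  "local_ring M \<longleftrightarrow> (\<forall>J. maximal_ideal J \<longleftrightarrow> J = M)"

definition residue_field :: "'r::comm_ring_1 set \<Rightarrow> 'r set set" where
  "residue_field M = UNIV // {(a, b). a - b \<in> M}"

text \<open>The library's \<^const>\<open>pderiv\<close> is only available over rings without zero divisors.\<close>

definition poly_deriv :: "'r::comm_ring_1 poly \<Rightarrow> 'r poly" where
  "poly_deriv f = (\<Sum>i\<le>degree f. monom (of_nat i * coeff f i) (i - 1))"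

text \<open>
  Simple roots in the residue field of monic polynomials lift to roots; both the simple root
  and the condition on its lift are expressed through representatives modulo \<open>M\<close>.
\<close>

definition henselian_local_ring :: "'r::comm_ring_1 set \<Rightarrow> bool" where
  "henselian_local_ring M \<longleftrightarrow> local_ring M \<and>
     (\<forall>f a. lead_coeff f = 1 \<and> poly f a \<in> M \<and> poly (poly_deriv f) a \<notin> M
        \<longrightarrow> (\<exists>b. poly f b = 0 \<and> b - a \<in> M))"


section \<open>Formal modules\<close>

text \<open>
  All identities between power series in at most three variables are stated in
  \<open>R[[X,Y,Z]]\<close>, realised as an iterated power series ring such that \<open>s $ i $ j $ k\<close> is the
  coefficient of \<open>X\<^sup>i Y\<^sup>j Z\<^sup>k\<close>. Likewise, \<open>F $ i $ j\<close> is the coefficient of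
  \<open>X\<^sup>i Y\<^sup>j\<close> in \<open>F \<in> R[[X,Y]]\<close>.
\<close>

type_synonym 'r fps2 = "'r fps fps"
type_synonym 'r fps3 = "'r fps fps fps"

definition Xv :: "'r::comm_ring_1 fps3" where "Xv = fps_X"
definition Yv :: "'r::comm_ring_1 fps3" where "Yv = fps_const fps_X"
definition Zv :: "'r::comm_ring_1 fps3" where "Zv = fps_const (fps_const fps_X)"

text \<open>
  The substitutions \<open>f(u)\<close> and \<open>F(u,v)\<close>, for \<open>u\<close>, \<open>v\<close> without constant term: then
  \<open>u\<^sup>m\<close> and \<open>u\<^sup>m v\<^sup>l\<close> do not contribute to the coefficient of
  \<open>X\<^sup>i Y\<^sup>j Z\<^sup>k\<close> when \<open>m\<close>, respectively \<open>m\<close> or \<open>l\<close>, exceeds \<open>i + j + k\<close>.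
\<close>

definition subst1 :: "'r::comm_ring_1 fps \<Rightarrow> 'r fps3 \<Rightarrow> 'r fps3" where
  "subst1 f u = Abs_fps (\<lambda>i. Abs_fps (\<lambda>j. Abs_fps (\<lambda>k.
     \<Sum>m\<le>i + j + k. f $ m * (u ^ m) $ i $ j $ k)))"

definition subst2 :: "'r::comm_ring_1 fps2 \<Rightarrow> 'r fps3 \<Rightarrow> 'r fps3 \<Rightarrow> 'r fps3" where
  "subst2 F u v = Abs_fps (\<lambda>i. Abs_fps (\<lambda>j. Abs_fps (\<lambda>k.
     \<Sum>m\<le>i + j + k. \<Sum>l\<le>i + j + k. F $ m $ l * (u ^ m * v ^ l) $ i $ j $ k)))"

definition formal_group_law :: "'r::comm_ring_1 fps2 \<Rightarrow> bool" where
  "formal_group_law F \<longleftrightarrow>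
     subst2 F Xv 0 = Xv \<and>
     subst2 F 0 Yv = Yv \<and>
     subst2 F Xv Yv = subst2 F Yv Xv \<and>
     subst2 F (subst2 F Xv Yv) Zv = subst2 F Xv (subst2 F Yv Zv)"

definition fgl_End :: "'r::comm_ring_1 fps2 \<Rightarrow> 'r fps set" where
  "fgl_End F = {f. f $ 0 = 0 \<and>
     subst1 f (subst2 F Xv Yv) = subst2 F (subst1 f Xv) (subst1 f Yv)}"

text \<open>
  The \<open>A\<close>-algebra structure of \<open>R\<close> is given by the structure map \<open>\<phi>\<close>. The last
  four conditions say that \<open>\<rho>\<close> is a ring homomorphism into \<open>End(F)\<close> (the unit of which is the
  series \<open>X\<close>) and that \<open>\<rho>(a)(X) \<equiv> aX\<close> modulo \<open>X\<^sup>2\<close>.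
\<close>

definition formal_module ::
    "('a::comm_ring_1 \<Rightarrow> 'r::comm_ring_1) \<Rightarrow> 'r fps2 \<Rightarrow> ('a \<Rightarrow> 'r fps) \<Rightarrow> bool" where
  "formal_module \<phi> F \<rho> \<longleftrightarrow>
     formal_group_law F \<and>
     (\<forall>a. \<rho> a \<in> fgl_End F) \<and>
     \<rho> 1 = fps_X \<and>
     (\<forall>a b. subst1 (\<rho> (a + b)) Xv = subst2 F (subst1 (\<rho> a) Xv) (subst1 (\<rho> b) Xv)) \<and>
     (\<forall>a b. \<rho> (a * b) = \<rho> a oo \<rho> b) \<and>
     (\<forall>a. \<rho> a $ 1 = \<phi> a)"


section \<open>The ring \<open>L\<^sup>A\<close>\<close>

text \<open>
  \<open>L\<^sup>A\<close> is the polynomial ring over \<open>A\<close> on the coefficients \<open>\<alpha>\<^sub>i\<^sub>j\<close> and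
  \<open>\<rho>\<^sub>a\<^sub>,\<^sub>i\<close> of the generic data, modulo the relations saying that these data form a formal
  module. That it corepresents formal modules is theorem \<open>lazard_universal\<close> below.
\<close>

datatype 'a fm_gen = Alpha nat nat | Rho 'a nat

type_synonym 'a fm_poly = "('a fm_gen \<Rightarrow>\<^sub>0 nat) \<Rightarrow>\<^sub>0 'a"

definition fm_const :: "'a::comm_ring_1 \<Rightarrow> 'a fm_poly" where
  "fm_const a = Poly_Mapping.single 0 a"

definition fm_var :: "'a fm_gen \<Rightarrow> 'a::comm_ring_1 fm_poly" where
  "fm_var g = Poly_Mapping.single (Poly_Mapping.single g 1) 1"

definition generic_F :: "'a::comm_ring_1 fm_poly fps2" where
  "generic_F = Abs_fps (\<lambda>i. Abs_fps (\<lambda>j. fm_var (Alpha i j)))"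

definition generic_rho :: "'a::comm_ring_1 \<Rightarrow> 'a fm_poly fps" where
  "generic_rho a = Abs_fps (\<lambda>i. fm_var (Rho a i))"

text \<open>The differences of the two sides of the identities in \<^const>\<open>formal_module\<close>.\<close>

definition defects3 :: "'r::comm_ring_1 fps2 \<Rightarrow> ('a::comm_ring_1 \<Rightarrow> 'r fps) \<Rightarrow> 'r fps3 set" where
  "defects3 F \<rho> =
     {subst2 F Xv 0 - Xv,
      subst2 F 0 Yv - Yv,
      subst2 F Xv Yv - subst2 F Yv Xv,
      subst2 F (subst2 F Xv Yv) Zv - subst2 F Xv (subst2 F Yv Zv)} \<union>
     range (\<lambda>a. subst1 (\<rho> a) (subst2 F Xv Yv) - subst2 F (subst1 (\<rho> a) Xv) (subst1 (\<rho> a) Yv)) \<union>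
     range (\<lambda>(a, b). subst1 (\<rho> (a + b)) Xv - subst2 F (subst1 (\<rho> a) Xv) (subst1 (\<rho> b) Xv))"

definition defects1 :: "('a::comm_ring_1 \<Rightarrow> 'r::comm_ring_1) \<Rightarrow> ('a \<Rightarrow> 'r fps) \<Rightarrow> 'r fps set" where
  "defects1 \<phi> \<rho> =
     {\<rho> 1 - fps_X} \<union>
     range (\<lambda>(a, b). \<rho> (a * b) - (\<rho> a oo \<rho> b)) \<union>
     range (\<lambda>a. fps_const (\<rho> a $ 0)) \<union>
     range (\<lambda>a. fps_const (\<rho> a $ 1 - \<phi> a))"

definition fm_relations ::
    "('a::comm_ring_1 \<Rightarrow> 'r::comm_ring_1) \<Rightarrow> 'r fps2 \<Rightarrow> ('a \<Rightarrow> 'r fps) \<Rightarrow> 'r set" where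
  "fm_relations \<phi> F \<rho> =
     {s $ i $ j $ k | s i j k. s \<in> defects3 F \<rho>} \<union> {s $ i | s i. s \<in> defects1 \<phi> \<rho>}"

lemma formal_module_iff_relations: "formal_module \<phi> F \<rho> \<longleftrightarrow> fm_relations \<phi> F \<rho> \<subseteq> {0}"
proof -
  have 3: "{s $ i $ j $ k | s i j k. s \<in> S} \<subseteq> {0} \<longleftrightarrow> (\<forall>s\<in>S. s = 0)" for S :: "'b fps3 set"
    unfolding subset_iff mem_Collect_eq singleton_iff fps_eq_iff by fastforce
  have 1: "{s $ i | s i. s \<in> S} \<subseteq> {0} \<longleftrightarrow> (\<forall>s\<in>S. s = 0)" for S :: "'b fps set"
    unfolding subset_iff mem_Collect_eq singleton_iff fps_eq_iff by fastforce
  have c: "fps_const x = 0 \<longleftrightarrow> x = 0" for x :: 'b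
    by simp
  show ?thesis
    unfolding fm_relations_def Un_subset_iff 3 1 formal_module_def formal_group_law_def
      fgl_End_def defects3_def defects1_def
    by (simp add: ball_Un c all_conj_distrib conj_ac)
qed

definition lazard_ideal :: "'a::comm_ring_1 fm_poly set" where
  "lazard_ideal = ideal_gen (fm_relations fm_const generic_F generic_rho)"

subsection \<open>Functoriality of the relations\<close>

definition fps_map :: "('r \<Rightarrow> 's) \<Rightarrow> 'r fps \<Rightarrow> 's fps" where
  "fps_map h f = Abs_fps (\<lambda>n. h (f $ n))"

abbreviation "fps_map2 h \<equiv> fps_map (fps_map h)"
abbreviation "fps_map3 h \<equiv> fps_map (fps_map (fps_map h))"

lemma fps_map_nth [simp]: "fps_map h f $ n = h (f $ n)"
  by (simp add: fps_map_def)

context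
  fixes h :: "'r::comm_ring_1 \<Rightarrow> 's::comm_ring_1"
  assumes h: "is_ring_hom h"
begin

lemma ring_hom_1: "h 1 = 1"
  and ring_hom_add: "h (x + y) = h x + h y"
  and ring_hom_mult: "h (x * y) = h x * h y"
  using h by (auto simp: is_ring_hom_def)

lemma ring_hom_0: "h 0 = 0"
  using ring_hom_add[of 0 0] by simp

lemma ring_hom_minus: "h (- x) = - h x"
  using ring_hom_add[of x "- x"] by (simp add: ring_hom_0 minus_unique)

lemma ring_hom_diff: "h (x - y) = h x - h y"
  using ring_hom_add[of x "- y"] by (simp add: ring_hom_minus)

lemma ring_hom_sum: "h (sum f S) = (\<Sum>x\<in>S. h (f x))"
  by (induction S rule: infinite_finite_induct) (simp_all add: ring_hom_0 ring_hom_add)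

lemma ring_hom_prod: "h (prod f S) = (\<Prod>x\<in>S. h (f x))"
  by (induction S rule: infinite_finite_induct) (simp_all add: ring_hom_1 ring_hom_mult)

lemma ring_hom_power: "h (x ^ n) = h x ^ n"
  by (induction n) (simp_all add: ring_hom_1 ring_hom_mult)

lemma is_ring_hom_fps_map: "is_ring_hom (fps_map h)"
  by (auto simp: is_ring_hom_def fps_eq_iff fps_mult_nth ring_hom_sum ring_hom_mult ring_hom_add
      ring_hom_0 ring_hom_1)

end

context
  fixes h :: "'r::comm_ring_1 \<Rightarrow> 's::comm_ring_1"
  assumes h: "is_ring_hom h"
begin

lemmas hom1 = is_ring_hom_fps_map[OF h]
lemmas hom2 = is_ring_hom_fps_map[OF hom1]
lemmas hom3 = is_ring_hom_fps_map[OF hom2]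

lemma fps_map_fps_X: "fps_map h fps_X = fps_X"
  by (simp add: fps_eq_iff fps_X_def ring_hom_0[OF h] ring_hom_1[OF h])

lemma fps_map_fps_const: "k 0 = 0 \<Longrightarrow> fps_map k (fps_const c) = fps_const (k c)"
  for k :: "'x::zero \<Rightarrow> 'y::zero"
  by (simp add: fps_eq_iff)

lemma fps_map3_Xv: "fps_map3 h Xv = Xv"
  by (auto simp: fps_eq_iff Xv_def fps_X_def ring_hom_0[OF h] ring_hom_1[OF h])

lemma fps_map3_Yv: "fps_map3 h Yv = Yv"
  by (auto simp: fps_eq_iff Yv_def fps_X_def ring_hom_0[OF h] ring_hom_1[OF h])

lemma fps_map3_Zv: "fps_map3 h Zv = Zv"
  by (auto simp: fps_eq_iff Zv_def fps_X_def ring_hom_0[OF h] ring_hom_1[OF h])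

lemma fps_map3_subst1: "fps_map3 h (subst1 f u) = subst1 (fps_map h f) (fps_map3 h u)"
  by (simp add: fps_eq_iff subst1_def ring_hom_sum[OF h] ring_hom_mult[OF h]
      flip: ring_hom_power[OF hom3])

lemma fps_map3_subst2:
  "fps_map3 h (subst2 F u v) = subst2 (fps_map2 h F) (fps_map3 h u) (fps_map3 h v)"
  by (simp add: fps_eq_iff subst2_def ring_hom_sum[OF h] ring_hom_mult[OF h]
      flip: ring_hom_power[OF hom3] ring_hom_mult[OF hom3])

lemma fps_map_compose: "fps_map h (f oo g) = fps_map h f oo fps_map h g"
  by (simp add: fps_eq_iff fps_compose_nth ring_hom_sum[OF h] ring_hom_mult[OF h]
      flip: ring_hom_power[OF hom1])

lemma defects3_map:
  "defects3 (fps_map2 h F) (\<lambda>a. fps_map h (\<rho> a)) = fps_map3 h ` defects3 F \<rho>"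
  by (simp add: defects3_def image_Un image_image case_prod_unfold ring_hom_diff[OF hom3]
      fps_map3_subst1 fps_map3_subst2 fps_map3_Xv fps_map3_Yv fps_map3_Zv ring_hom_0[OF hom3])

lemma defects1_map:
  "defects1 (\<lambda>a. h (\<phi> a)) (\<lambda>a. fps_map h (\<rho> a)) = fps_map h ` defects1 \<phi> \<rho>"
  by (simp add: defects1_def image_Un image_image case_prod_unfold ring_hom_diff[OF hom1]
      fps_map_compose fps_map_fps_X fps_map_fps_const ring_hom_0[OF h] ring_hom_diff[OF h])

lemma fm_relations_map:
  "fm_relations (\<lambda>a. h (\<phi> a)) (fps_map2 h F) (\<lambda>a. fps_map h (\<rho> a)) = h ` fm_relations \<phi> F \<rho>"
proof -
  have 3: "{s $ i $ j $ k | s i j k. s \<in> fps_map3 h ` S} = h ` {s $ i $ j $ k | s i j k. s \<in> S}"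
    for S by (auto simp: image_iff) (metis fps_map_nth)+
  have 1: "{s $ i | s i. s \<in> fps_map h ` S} = h ` {s $ i | s i. s \<in> S}"
    for S by (auto simp: image_iff) (metis fps_map_nth)+
  show ?thesis
    unfolding fm_relations_def defects3_map defects1_map 3 1 image_Un ..
qed

end


subsection \<open>Evaluation homomorphisms on the polynomial ring\<close>

definition eval_monom :: "('g \<Rightarrow> 'r::comm_ring_1) \<Rightarrow> ('g \<Rightarrow>\<^sub>0 nat) \<Rightarrow> 'r" where
  "eval_monom v m = (\<Prod>g\<in>Poly_Mapping.keys m. v g ^ Poly_Mapping.lookup m g)"

definition fm_eval ::
    "('a::comm_ring_1 \<Rightarrow> 'r::comm_ring_1) \<Rightarrow> ('a fm_gen \<Rightarrow> 'r) \<Rightarrow> 'a fm_poly \<Rightarrow> 'r" where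
  "fm_eval \<phi> v p =
     (\<Sum>m\<in>Poly_Mapping.keys p. \<phi> (Poly_Mapping.lookup p m) * eval_monom v m)"

lemma eval_monom_superset:
  assumes "finite S" "Poly_Mapping.keys m \<subseteq> S"
  shows "eval_monom v m = (\<Prod>g\<in>S. v g ^ Poly_Mapping.lookup m g)"
  unfolding eval_monom_def using assms
  by (intro prod.mono_neutral_left) (auto simp: in_keys_iff)

lemma eval_monom_add: "eval_monom v (m + n) = eval_monom v m * eval_monom v n"
proof -
  let ?S = "Poly_Mapping.keys m \<union> Poly_Mapping.keys n"
  have "finite ?S" by simp
  then show ?thesis
    using Poly_Mapping.keys_add[of m n]
    by (simp add: eval_monom_superset[of ?S] lookup_add power_add prod.distrib)
qed

lemma eval_monom_0: "eval_monom v 0 = 1"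
  by (simp add: eval_monom_def)

lemma eval_monom_single: "eval_monom v (Poly_Mapping.single g k) = v g ^ k"
  by (simp add: eval_monom_def)

lemma poly_mapping_as_sum:
  "p = (\<Sum>m\<in>Poly_Mapping.keys p. Poly_Mapping.single m (Poly_Mapping.lookup p m))"
  by (rule poly_mapping_eqI)
     (auto simp: lookup_sum lookup_single when_def in_keys_iff sum.delta)

context
  fixes \<phi> :: "'a::comm_ring_1 \<Rightarrow> 'r::comm_ring_1" and v :: "'a fm_gen \<Rightarrow> 'r"
  assumes \<phi>: "is_ring_hom \<phi>"
begin

lemma fm_eval_superset:
  assumes "finite S" "Poly_Mapping.keys p \<subseteq> S"
  shows "fm_eval \<phi> v p = (\<Sum>m\<in>S. \<phi> (Poly_Mapping.lookup p m) * eval_monom v m)"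
  unfolding fm_eval_def using assms
  by (intro sum.mono_neutral_left) (auto simp: in_keys_iff ring_hom_0[OF \<phi>])

lemma fm_eval_single: "fm_eval \<phi> v (Poly_Mapping.single m c) = \<phi> c * eval_monom v m"
  by (simp add: fm_eval_def ring_hom_0[OF \<phi>])

lemma fm_eval_add: "fm_eval \<phi> v (p + q) = fm_eval \<phi> v p + fm_eval \<phi> v q"
proof -
  let ?S = "Poly_Mapping.keys p \<union> Poly_Mapping.keys q"
  have "finite ?S" by simp
  then show ?thesis
    using Poly_Mapping.keys_add[of p q]
    by (simp add: fm_eval_superset[of ?S] lookup_add ring_hom_add[OF \<phi>] algebra_simps sum.distrib)
qed

lemma fm_eval_0: "fm_eval \<phi> v 0 = 0"
  by (simp add: fm_eval_def)

lemma fm_eval_sum: "fm_eval \<phi> v (sum f S) = (\<Sum>x\<in>S. fm_eval \<phi> v (f x))"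
  by (induction S rule: infinite_finite_induct) (simp_all add: fm_eval_0 fm_eval_add)

lemma fm_eval_mult: "fm_eval \<phi> v (p * q) = fm_eval \<phi> v p * fm_eval \<phi> v q"
proof -
  have "fm_eval \<phi> v (p * q) =
      fm_eval \<phi> v (\<Sum>m\<in>Poly_Mapping.keys p. \<Sum>n\<in>Poly_Mapping.keys q.
        Poly_Mapping.single (m + n) (Poly_Mapping.lookup p m * Poly_Mapping.lookup q n))"
    by (subst (1) poly_mapping_as_sum[of p], subst (1) poly_mapping_as_sum[of q])
       (simp only: sum_product mult_single)
  also have "\<dots> = fm_eval \<phi> v p * fm_eval \<phi> v q"
    unfolding fm_eval_sum fm_eval_single fm_eval_def[of \<phi> v p] fm_eval_def[of \<phi> v q] sum_product
    by (simp add: eval_monom_add ring_hom_mult[OF \<phi>] algebra_simps)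
  finally show ?thesis .
qed

lemma is_ring_hom_fm_eval: "is_ring_hom (fm_eval \<phi> v)"
  by (auto simp: is_ring_hom_def fm_eval_add fm_eval_mult)
     (simp add: fm_eval_def eval_monom_0 ring_hom_1[OF \<phi>])

lemma fm_eval_const: "fm_eval \<phi> v (fm_const a) = \<phi> a"
  by (simp add: fm_const_def fm_eval_single eval_monom_0)

lemma fm_eval_var: "fm_eval \<phi> v (fm_var g) = v g"
  by (simp add: fm_var_def fm_eval_single eval_monom_single ring_hom_1[OF \<phi>])

end

lemma is_ring_hom_fm_const: "is_ring_hom fm_const"
  by (simp add: is_ring_hom_def fm_const_def single_add mult_single)

lemma fm_var_power: "fm_var g ^ k = Poly_Mapping.single (Poly_Mapping.single g k) 1"
  by (induction k) (simp_all add: fm_var_def mult_single flip: single_add)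

lemma eval_monom_fm_var: "eval_monom fm_var m = (Poly_Mapping.single m 1 :: 'a::comm_ring_1 fm_poly)"
proof -
  have *: "(\<Prod>g\<in>S. Poly_Mapping.single (f g) (1::'a)) = Poly_Mapping.single (sum f S) 1"
    for S and f :: "'a fm_gen \<Rightarrow> 'a fm_gen \<Rightarrow>\<^sub>0 nat"
    by (induction S rule: infinite_finite_induct) (simp_all add: mult_single)
  show ?thesis
    unfolding eval_monom_def fm_var_power *
    by (simp flip: poly_mapping_as_sum)
qed

lemma fm_eval_unique:
  assumes "is_ring_hom h"
  shows "h p = fm_eval (\<lambda>a. h (fm_const a)) (\<lambda>g. h (fm_var g)) p"
proof -
  have m: "h (Poly_Mapping.single m 1) = eval_monom (\<lambda>g. h (fm_var g)) m" for m
    by (simp add: eval_monom_def ring_hom_prod[OF assms] ring_hom_power[OF assms]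
        flip: eval_monom_fm_var)
  have "Poly_Mapping.single m c = fm_const c * Poly_Mapping.single m 1" for m and c :: 'a
    by (simp add: fm_const_def mult_single)
  then have "h (Poly_Mapping.single m c) = h (fm_const c) * eval_monom (\<lambda>g. h (fm_var g)) m" for m c
    by (metis m ring_hom_mult[OF assms])
  then show ?thesis
    by (subst poly_mapping_as_sum) (simp add: ring_hom_sum[OF assms] fm_eval_def)
qed

text \<open>A formal module over \<open>R\<close> induces a homomorphism that kills the relations.\<close>

definition classify ::
    "('a::comm_ring_1 \<Rightarrow> 'r::comm_ring_1) \<Rightarrow> 'r fps2 \<Rightarrow> ('a \<Rightarrow> 'r fps) \<Rightarrow> 'a fm_poly \<Rightarrow> 'r" where
  "classify \<phi> F \<rho> =
     fm_eval \<phi> (\<lambda>g. case g of Alpha i j \<Rightarrow> F $ i $ j | Rho a i \<Rightarrow> \<rho> a $ i)"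

lemma ring_hom_ideal_gen_zero:
  assumes h: "is_ring_hom h" and "h ` S \<subseteq> {0}" and "x \<in> ideal_gen S"
  shows "h x = 0"
proof -
  from assms(3) obtain t r where "t \<subseteq> S" "x = (\<Sum>a\<in>t. r a * a)"
    by (auto simp: module.span_explicit[OF module_times])
  moreover have "h a = 0" if "a \<in> S" for a
    using assms(2) that by blast
  ultimately show ?thesis
    by (auto simp: ring_hom_sum[OF h] ring_hom_mult[OF h] intro!: sum.neutral)
qed

lemma classify_lazard_ideal:
  assumes \<phi>: "is_ring_hom \<phi>" and fm: "formal_module \<phi> F \<rho>" and p: "p \<in> lazard_ideal"
  shows "classify \<phi> F \<rho> p = 0"
proof -
  let ?h = "classify \<phi> F \<rho>"
  have h: "is_ring_hom ?h"
    unfolding classify_def by (rule is_ring_hom_fm_eval[OF \<phi>])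
  have "(\<lambda>a. ?h (fm_const a)) = \<phi>"
    by (simp add: classify_def fm_eval_const[OF \<phi>] fun_eq_iff)
  moreover have "fps_map2 ?h generic_F = F"
    by (simp add: fps_eq_iff generic_F_def classify_def fm_eval_var[OF \<phi>])
  moreover have "(\<lambda>a. fps_map ?h (generic_rho a)) = \<rho>"
    by (simp add: fun_eq_iff fps_eq_iff generic_rho_def classify_def fm_eval_var[OF \<phi>])
  ultimately have "?h ` fm_relations fm_const generic_F generic_rho = fm_relations \<phi> F \<rho>"
    using fm_relations_map[OF h, of fm_const generic_F generic_rho] by simp
  also have "\<dots> \<subseteq> {0}"
    using fm by (simp add: formal_module_iff_relations)
  finally show ?thesis
    using p unfolding lazard_ideal_def by (rule ring_hom_ideal_gen_zero[OF h])
qed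


subsection \<open>The additive formal module\<close>

text \<open>It shows that the ideal of relations is proper.\<close>

definition additive_F :: "'a::comm_ring_1 fps2" where
  "additive_F = Abs_fps (\<lambda>i. Abs_fps (\<lambda>j. if i + j = 1 then 1 else 0))"

definition additive_rho :: "'a::comm_ring_1 \<Rightarrow> 'a fps" where
  "additive_rho a = fps_const a * fps_X"

lemma subst2_additive:
  assumes "u $ 0 $ 0 $ 0 = 0" "v $ 0 $ 0 $ 0 = 0"
  shows "subst2 additive_F u v = u + v"
proof -
  have "subst2 additive_F u v $ i $ j $ k = (u + v) $ i $ j $ k" for i j k
  proof (cases "i + j + k = 0")
    case True
    then show ?thesis using assms by (simp add: subst2_def additive_F_def)
  next
    case False
    define N where "N = i + j + k"
    have N: "N \<ge> 1" using False by (auto simp: N_def)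
    let ?f = "\<lambda>m l. (u ^ m * v ^ l) $ i $ j $ k"
    have "subst2 additive_F u v $ i $ j $ k =
        (\<Sum>(m, l)\<in>{..N} \<times> {..N}. (if m + l = 1 then 1 else 0) * ?f m l)"
      by (simp add: subst2_def additive_F_def N_def sum.cartesian_product)
    also have "\<dots> = (\<Sum>(m, l)\<in>{(1, 0), (0, 1)}. (if m + l = 1 then 1 else 0) * ?f m l)"
      by (rule sum.mono_neutral_right) (use N in \<open>auto simp: add_eq_if split: if_splits\<close>)
    also have "\<dots> = (u + v) $ i $ j $ k"
      by simp
    finally show ?thesis .
  qed
  then show ?thesis by (simp add: fps_eq_iff)
qed

lemma subst1_additive:
  assumes "u $ 0 $ 0 $ 0 = 0"
  shows "subst1 (additive_rho a) u = fps_const (fps_const (fps_const a)) * u"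
proof -
  have "subst1 (additive_rho a) u $ i $ j $ k = a * u $ i $ j $ k" for i j k
  proof (cases "i + j + k = 0")
    case True
    then show ?thesis using assms by (simp add: subst1_def additive_rho_def)
  next
    case False
    have "subst1 (additive_rho a) u $ i $ j $ k =
        (\<Sum>m\<le>i + j + k. if m = 1 then a * u $ i $ j $ k else 0)"
      unfolding subst1_def additive_rho_def fps_nth_Abs_fps
      by (rule sum.cong) (auto simp: fps_X_def)
    moreover have "1 \<le> i + j + k" using False by linarith
    ultimately show ?thesis by simp
  qed
  then show ?thesis by (simp add: fps_eq_iff)
qed

lemma formal_module_additive: "formal_module (\<lambda>a. a) additive_F additive_rho"
proof -
  have [simp]: "(Xv :: 'a fps3) $ 0 $ 0 $ 0 = 0" "(Yv :: 'a fps3) $ 0 $ 0 $ 0 = 0"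
      "(Zv :: 'a fps3) $ 0 $ 0 $ 0 = 0"
    by (simp_all add: Xv_def Yv_def Zv_def)
  have "additive_rho a oo additive_rho b = additive_rho (a * b)" for a b :: 'a
  proof (rule fps_ext)
    fix n
    have "(additive_rho a oo additive_rho b) $ n =
        (\<Sum>i\<in>{0..n}. if i = 1 then a * additive_rho b $ n else 0)"
      unfolding fps_compose_nth by (rule sum.cong) (auto simp: additive_rho_def fps_X_def)
    also have "\<dots> = additive_rho (a * b) $ n"
      by (auto simp: additive_rho_def fps_X_def)
    finally show "(additive_rho a oo additive_rho b) $ n = additive_rho (a * b) $ n" .
  qed
  then show ?thesis
    by (simp add: formal_module_def formal_group_law_def fgl_End_def subst2_additive
        subst1_additive algebra_simps flip: fps_const_add) (simp add: additive_rho_def)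
qed

lemma one_notin_lazard_ideal: "1 \<notin> lazard_ideal"
proof
  assume "(1 :: 'a fm_poly) \<in> lazard_ideal"
  moreover have id: "is_ring_hom (\<lambda>a::'a. a)"
    by (simp add: is_ring_hom_def)
  ultimately have "classify (\<lambda>a::'a. a) additive_F additive_rho 1 = 0"
    by (intro classify_lazard_ideal formal_module_additive)
  then show False
    by (simp add: classify_def ring_hom_1[OF is_ring_hom_fm_eval[OF id]])
qed


subsection \<open>The quotient and its universal property\<close>

definition lazard_cong :: "'a::comm_ring_1 fm_poly \<Rightarrow> 'a fm_poly \<Rightarrow> bool" where
  "lazard_cong p q \<longleftrightarrow> p - q \<in> lazard_ideal"

lemma lazard_ideal: "is_ideal (lazard_ideal :: 'a::comm_ring_1 fm_poly set)"
  unfolding lazard_ideal_def by (rule module.subspace_span[OF module_times])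

lemmas lazard_ideal_0 = module.subspace_0[OF module_times lazard_ideal]
  and lazard_ideal_add = module.subspace_add[OF module_times lazard_ideal]
  and lazard_ideal_diff = module.subspace_diff[OF module_times lazard_ideal]
  and lazard_ideal_neg = module.subspace_neg[OF module_times lazard_ideal]
  and lazard_ideal_mult = module.subspace_scale[OF module_times lazard_ideal]

lemma equivp_lazard_cong: "equivp (lazard_cong :: 'a::comm_ring_1 fm_poly \<Rightarrow> _)"
proof (rule equivpI)
  show "reflp (lazard_cong :: 'a fm_poly \<Rightarrow> _)"
    by (rule reflpI) (simp add: lazard_cong_def lazard_ideal_0)
  show "symp (lazard_cong :: 'a fm_poly \<Rightarrow> _)"
    by (rule sympI) (metis lazard_cong_def lazard_ideal_neg minus_diff_eq)
  show "transp (lazard_cong :: 'a fm_poly \<Rightarrow> _)"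
  proof (rule transpI)
    fix p q r :: "'a fm_poly"
    assume "lazard_cong p q" "lazard_cong q r"
    then have "(p - q) + (q - r) \<in> lazard_ideal"
      unfolding lazard_cong_def by (rule lazard_ideal_add)
    then show "lazard_cong p r" by (simp add: lazard_cong_def)
  qed
qed

quotient_type (overloaded) 'a lazard = "'a::comm_ring_1 fm_poly" / lazard_cong
  by (rule equivp_lazard_cong)

instantiation lazard :: (comm_ring_1) comm_ring_1
begin

lift_definition zero_lazard :: "'a lazard" is 0 .
lift_definition one_lazard :: "'a lazard" is 1 .

lift_definition plus_lazard :: "'a lazard \<Rightarrow> 'a lazard \<Rightarrow> 'a lazard" is "(+)"
  unfolding lazard_cong_def by (drule (1) lazard_ideal_add) (simp add: algebra_simps)

lift_definition uminus_lazard :: "'a lazard \<Rightarrow> 'a lazard" is uminus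
  unfolding lazard_cong_def by (drule lazard_ideal_neg) (simp add: algebra_simps)

lift_definition minus_lazard :: "'a lazard \<Rightarrow> 'a lazard \<Rightarrow> 'a lazard" is "(-)"
  unfolding lazard_cong_def by (drule (1) lazard_ideal_diff) (simp add: algebra_simps)

lift_definition times_lazard :: "'a lazard \<Rightarrow> 'a lazard \<Rightarrow> 'a lazard" is "(*)"
proof -
  fix p p' q q' :: "'a fm_poly"
  assume "lazard_cong p p'" "lazard_cong q q'"
  then have "q * (p - p') + p' * (q - q') \<in> lazard_ideal"
    unfolding lazard_cong_def by (intro lazard_ideal_add lazard_ideal_mult)
  then show "lazard_cong (p * q) (p' * q')"
    by (simp add: lazard_cong_def algebra_simps)
qed

instance
proof
  fix a b c :: "'a lazard"
  show "(0 :: 'a lazard) \<noteq> 1"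
    by transfer (metis lazard_cong_def diff_0 lazard_ideal_neg minus_minus one_notin_lazard_ideal)
  show "a * b * c = a * (b * c)" "a * b = b * a" "1 * a = a" "a + b + c = a + (b + c)"
    "a + b = b + a" "0 + a = a" "- a + a = 0" "a - b = a + - b" "(a + b) * c = a * c + b * c"
    by (transfer, simp add: lazard_cong_def lazard_ideal_0 algebra_simps)+
qed

end

definition lazard_of :: "'a::comm_ring_1 \<Rightarrow> 'a lazard" where
  "lazard_of a = abs_lazard (fm_const a)"

definition lazard_F :: "'a::comm_ring_1 lazard fps2" where
  "lazard_F = fps_map2 abs_lazard generic_F"

definition lazard_rho :: "'a::comm_ring_1 \<Rightarrow> 'a lazard fps" where
  "lazard_rho a = fps_map abs_lazard (generic_rho a)"

lemma is_ring_hom_abs_lazard: "is_ring_hom abs_lazard"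
  by (simp add: is_ring_hom_def one_lazard.abs_eq plus_lazard.abs_eq times_lazard.abs_eq)

lemma is_ring_hom_lazard_of: "is_ring_hom lazard_of"
  using is_ring_hom_abs_lazard is_ring_hom_fm_const
  unfolding is_ring_hom_def lazard_of_def by metis

lemma abs_lazard_eq_0_iff: "abs_lazard p = 0 \<longleftrightarrow> p \<in> lazard_ideal"
  by (simp add: zero_lazard.abs_eq lazard.abs_eq_iff lazard_cong_def)

theorem lazard_formal_module: "formal_module lazard_of lazard_F lazard_rho"
proof -
  have "fm_relations lazard_of lazard_F lazard_rho =
      abs_lazard ` fm_relations fm_const generic_F generic_rho"
    using fm_relations_map[OF is_ring_hom_abs_lazard, of fm_const generic_F generic_rho]
    by (simp add: lazard_of_def[abs_def] lazard_F_def lazard_rho_def[abs_def])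
  also have "\<dots> \<subseteq> {0}"
    by (auto simp: abs_lazard_eq_0_iff lazard_ideal_def intro: module.span_base[OF module_times])
  finally show ?thesis by (simp add: formal_module_iff_relations)
qed

theorem lazard_universal:
  fixes \<phi> :: "'a::comm_ring_1 \<Rightarrow> 'r::comm_ring_1" and F :: "'r fps2" and \<rho> :: "'a \<Rightarrow> 'r fps"
  assumes \<phi>: "is_ring_hom \<phi>" and fm: "formal_module \<phi> F \<rho>"
  shows "\<exists>!h. is_ring_hom h \<and> (\<forall>a. h (lazard_of a) = \<phi> a) \<and>
    fps_map2 h lazard_F = F \<and> (\<forall>a. fps_map h (lazard_rho a) = \<rho> a)"
proof -
  let ?c = "classify \<phi> F \<rho>"
  define h where "h x = ?c (rep_lazard x)" for x
  have c: "is_ring_hom ?c"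
    unfolding classify_def by (rule is_ring_hom_fm_eval[OF \<phi>])
  have h_abs: "h (abs_lazard p) = ?c p" for p
  proof -
    have "abs_lazard (rep_lazard (abs_lazard p)) = abs_lazard p"
      by (rule Quotient3_abs_rep[OF Quotient3_lazard])
    then have "rep_lazard (abs_lazard p) - p \<in> lazard_ideal"
      by (simp add: lazard.abs_eq_iff lazard_cong_def)
    then have "?c (rep_lazard (abs_lazard p) - p) = 0"
      by (rule classify_lazard_ideal[OF \<phi> fm])
    then show ?thesis by (simp add: h_def ring_hom_diff[OF c])
  qed
  have surj: "\<exists>p. x = abs_lazard p" for x :: "'a lazard"
    by (metis Quotient3_abs_rep[OF Quotient3_lazard])
  have "is_ring_hom h"
    unfolding is_ring_hom_def
  proof (intro conjI allI)
    show "h 1 = 1"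
      by (simp add: one_lazard.abs_eq h_abs ring_hom_1[OF c])
    fix x y :: "'a lazard"
    obtain p q where "x = abs_lazard p" "y = abs_lazard q"
      using surj by metis
    then show "h (x + y) = h x + h y" "h (x * y) = h x * h y"
      by (simp_all add: plus_lazard.abs_eq times_lazard.abs_eq h_abs
          ring_hom_add[OF c] ring_hom_mult[OF c])
  qed
  moreover have "h (lazard_of a) = \<phi> a" for a
    by (simp add: lazard_of_def h_abs classify_def fm_eval_const[OF \<phi>])
  moreover have "fps_map2 h lazard_F = F"
    by (simp add: fps_eq_iff lazard_F_def generic_F_def h_abs classify_def fm_eval_var[OF \<phi>])
  moreover have "fps_map h (lazard_rho a) = \<rho> a" for a
    by (simp add: fps_eq_iff lazard_rho_def generic_rho_def h_abs classify_def fm_eval_var[OF \<phi>])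
  moreover have "g = h" if g: "is_ring_hom g" "\<forall>a. g (lazard_of a) = \<phi> a"
    "fps_map2 g lazard_F = F" "\<forall>a. fps_map g (lazard_rho a) = \<rho> a" for g
  proof
    fix x :: "'a lazard"
    obtain p where x: "x = abs_lazard p"
      using surj by metis
    have ga: "is_ring_hom (\<lambda>p. g (abs_lazard p))"
      by (simp add: is_ring_hom_def ring_hom_1[OF g(1)] ring_hom_add[OF g(1)] ring_hom_mult[OF g(1)]
          ring_hom_1[OF is_ring_hom_abs_lazard] ring_hom_add[OF is_ring_hom_abs_lazard]
          ring_hom_mult[OF is_ring_hom_abs_lazard])
    have "g (abs_lazard (fm_var v)) = (case v of Alpha i j \<Rightarrow> F $ i $ j | Rho a i \<Rightarrow> \<rho> a $ i)" for v
    proof (cases v)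
      case (Alpha i j)
      then show ?thesis
        unfolding g(3)[symmetric] by (simp add: lazard_F_def generic_F_def)
    next
      case (Rho a i)
      then show ?thesis
        unfolding g(4)[rule_format, symmetric] by (simp add: lazard_rho_def generic_rho_def)
    qed
    moreover have "g (abs_lazard (fm_const a)) = \<phi> a" for a
      using g(2) by (simp add: lazard_of_def)
    ultimately have "g (abs_lazard p) = ?c p"
      using fm_eval_unique[OF ga, of p] by (simp add: classify_def)
    then show "g x = h x" by (simp add: x h_abs)
  qed
  ultimately show ?thesis
    by (intro ex1I[of _ h]) blast+
qed


section \<open>The grading and the quotient by the decomposables\<close>

text \<open>
  The truncated subtraction only affects \<open>\<alpha>\<^sub>0\<^sub>0\<close> and \<open>\<rho>\<^sub>a\<^sub>,\<^sub>0\<close>, which vanish in \<open>L\<^sup>A\<close>.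
\<close>

fun fm_gen_degree :: "'a fm_gen \<Rightarrow> nat" where
  "fm_gen_degree (Alpha i j) = 2 * (i + j - 1)"
| "fm_gen_degree (Rho a i) = 2 * (i - 1)"

definition fm_monom_degree :: "('a fm_gen \<Rightarrow>\<^sub>0 nat) \<Rightarrow> nat" where
  "fm_monom_degree m =
     (\<Sum>g\<in>Poly_Mapping.keys m. Poly_Mapping.lookup m g * fm_gen_degree g)"

text \<open>The homogeneous elements of \<open>L\<^sup>A\<close> of degree \<open>d\<close>.\<close>

definition lazard_degree :: "nat \<Rightarrow> 'a::comm_ring_1 lazard set" where
  "lazard_degree d = abs_lazard ` {p. \<forall>m\<in>Poly_Mapping.keys p. fm_monom_degree m = d}"

definition decomposables :: "'a::comm_ring_1 lazard set" where
  "decomposables =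
     ideal_gen {x * y | x y i j. i > 0 \<and> j > 0 \<and> x \<in> lazard_degree i \<and> y \<in> lazard_degree j}"

definition indec_cong :: "'a::comm_ring_1 lazard \<Rightarrow> 'a lazard \<Rightarrow> bool" where
  "indec_cong x y \<longleftrightarrow> x - y \<in> decomposables"

lemma ideal_decomposables: "is_ideal (decomposables :: 'a::comm_ring_1 lazard set)"
  unfolding decomposables_def by (rule module.subspace_span[OF module_times])

lemmas decomposables_0 = module.subspace_0[OF module_times ideal_decomposables]
  and decomposables_add = module.subspace_add[OF module_times ideal_decomposables]
  and decomposables_diff = module.subspace_diff[OF module_times ideal_decomposables]
  and decomposables_neg = module.subspace_neg[OF module_times ideal_decomposables]
  and decomposables_mult = module.subspace_scale[OF module_times ideal_decomposables]

lemma equivp_indec_cong: "equivp (indec_cong :: 'a::comm_ring_1 lazard \<Rightarrow> _)"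
proof (rule equivpI)
  show "reflp (indec_cong :: 'a lazard \<Rightarrow> _)"
    by (rule reflpI) (simp add: indec_cong_def decomposables_0)
  show "symp (indec_cong :: 'a lazard \<Rightarrow> _)"
    by (rule sympI) (metis indec_cong_def decomposables_neg minus_diff_eq)
  show "transp (indec_cong :: 'a lazard \<Rightarrow> _)"
  proof (rule transpI)
    fix p q r :: "'a lazard"
    assume "indec_cong p q" "indec_cong q r"
    then have "(p - q) + (q - r) \<in> decomposables"
      unfolding indec_cong_def by (rule decomposables_add)
    then show "indec_cong p r" by (simp add: indec_cong_def)
  qed
qed

text \<open>The quotient of \<open>L\<^sup>A\<close> by the decomposables, as an \<open>A\<close>-module.\<close>

quotient_type (overloaded) 'a lazard_indec = "'a::comm_ring_1 lazard" / indec_cong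
  by (rule equivp_indec_cong)

instantiation lazard_indec :: (comm_ring_1) ab_group_add
begin

lift_definition zero_lazard_indec :: "'a lazard_indec" is 0 .

lift_definition plus_lazard_indec :: "'a lazard_indec \<Rightarrow> 'a lazard_indec \<Rightarrow> 'a lazard_indec" is "(+)"
  unfolding indec_cong_def by (drule (1) decomposables_add) (simp add: algebra_simps)

lift_definition uminus_lazard_indec :: "'a lazard_indec \<Rightarrow> 'a lazard_indec" is uminus
  unfolding indec_cong_def by (drule decomposables_neg) (simp add: algebra_simps)

lift_definition minus_lazard_indec :: "'a lazard_indec \<Rightarrow> 'a lazard_indec \<Rightarrow> 'a lazard_indec" is "(-)"
  unfolding indec_cong_def by (drule (1) decomposables_diff) (simp add: algebra_simps)

instance
  by standard (transfer; simp add: indec_cong_def decomposables_0 algebra_simps)+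

end

lift_definition indec_scale :: "'a::comm_ring_1 \<Rightarrow> 'a lazard_indec \<Rightarrow> 'a lazard_indec"
  is "\<lambda>a x. lazard_of a * x"
proof -
  fix a :: 'a and x y :: "'a lazard"
  assume "indec_cong x y"
  then have "lazard_of a * (x - y) \<in> decomposables"
    unfolding indec_cong_def by (rule decomposables_mult)
  then show "indec_cong (lazard_of a * x) (lazard_of a * y)"
    by (simp add: indec_cong_def algebra_simps)
qed

lemma module_indec_scale: "module indec_scale"
  by standard
     (transfer; simp add: indec_cong_def decomposables_0 algebra_simps
        ring_hom_1[OF is_ring_hom_lazard_of] ring_hom_add[OF is_ring_hom_lazard_of]
        ring_hom_mult[OF is_ring_hom_lazard_of])+

definition indec_degree :: "nat \<Rightarrow> 'a::comm_ring_1 lazard_indec set" where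
  "indec_degree d = abs_lazard_indec ` lazard_degree d"

end

theory Submission
  imports "HOL-Algebra.Multiplicative_Group" "HOL-Algebra.Sylow" Defs
begin

text \<open>
  The quotient \<open>R = L\<^sup>A/D\<^sup>A\<close> is a ring in which products of elements of positive degree vanish.
  Expanding the axioms of the formal module over \<open>R\<close> to first order in the nonlinear coefficients
  yields Drinfeld's relations between \<open>f\<^sub>i\<close>, the coefficient of \<open>X\<^sup>i Y\<^bsup>n-i\<^esup>\<close>, and
  \<open>c\<^sub>a\<close>, the coefficient of \<open>X\<^sup>n\<close> in \<open>\<rho>(a)\<close>; these elements span degree \<open>2n - 2\<close>. That the
  relations are a complete set is not needed for bounding the number of generators.

  Let \<open>p\<close> be the residue characteristic (any prime if that is \<open>0\<close>) and \<open>p\<^sup>k < n \<le> p\<^bsup>k+1\<^esup>\<close>.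
  As in Lazard's lemma, the cocycle relation makes every \<open>f\<^sub>i\<close> a multiple of \<open>f\<^sub>d\<close>,
  \<open>d = p\<^sup>k\<close>. If some binomial coefficient of \<open>n\<close> is a unit, \<open>f\<^sub>d\<close> generates; if some
  \<open>a\<^sup>n - a\<close> is a unit, \<open>c\<^sub>a\<close> generates. Otherwise \<open>x\<^sup>n = x\<close> on the residue field, which
  is therefore finite of order \<open>q\<close> with \<open>n\<close> a power of \<open>q\<close>. By Hensel's lemma each \<open>a\<close> is
  \<open>t + s\<close> with \<open>t\<^sup>n = t\<close> and \<open>s \<in> M\<close>. Then \<open>c\<^sub>t = c\<^bsub>t^n\<^esub> = n t\<^bsup>n-1\<^esup> c\<^sub>t\<close> forces \<open>c\<^sub>t = 0\<close>,
  while \<open>s c\<^sub>b\<close> is a multiple of \<open>c\<^sub>s\<close>, so that \<open>f\<^sub>d\<close> and the \<open>c\<^sub>s\<close> for \<open>s\<close> in a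
  generating set of \<open>M\<close> suffice.
\<close>

subsection \<open>The ring of indecomposables\<close>

lemma eval_monom_graded:
  fixes v :: "'a fm_gen \<Rightarrow> 'r::comm_ring_1" and V :: "nat \<Rightarrow> 'r set"
  assumes one: "1 \<in> V 0" and mult: "\<And>i j x y. x \<in> V i \<Longrightarrow> y \<in> V j \<Longrightarrow> x * y \<in> V (i + j)"
    and gen: "\<And>g. v g \<in> V (fm_gen_degree g)"
  shows "eval_monom v m \<in> V (fm_monom_degree m)"
proof -
  have pow: "v g ^ k \<in> V (k * fm_gen_degree g)" for g k
    by (induction k) (use one mult[OF gen] in \<open>auto\<close>)
  have "(\<Prod>g\<in>S. v g ^ e g) \<in> V (\<Sum>g\<in>S. e g * fm_gen_degree g)" if "finite S" for S e
    using that by (induction S) (use one mult[OF pow] in \<open>auto\<close>)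
  then show ?thesis
    by (simp add: eval_monom_def fm_monom_degree_def)
qed

text \<open>\<open>V\<close> only has to contain the images of variables and constants and be closed
  under sums and graded products; no direct sum is required. So the argument covers both a family
  that is zero in positive degrees and the spans in \<open>indec_part\<close>.\<close>

lemma ring_hom_graded:
  fixes h :: "'a::comm_ring_1 fm_poly \<Rightarrow> 'r::comm_ring_1" and V :: "nat \<Rightarrow> 'r set"
  assumes h: "is_ring_hom h"
    and one: "1 \<in> V 0" and mult: "\<And>i j x y. x \<in> V i \<Longrightarrow> y \<in> V j \<Longrightarrow> x * y \<in> V (i + j)"
    and gen: "\<And>g. h (fm_var g) \<in> V (fm_gen_degree g)"
    and zero: "\<And>i. 0 \<in> V i" and add: "\<And>i x y. x \<in> V i \<Longrightarrow> y \<in> V i \<Longrightarrow> x + y \<in> V i"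
    and const: "\<And>a. h (fm_const a) \<in> V 0"
    and p: "\<forall>m\<in>Poly_Mapping.keys p. fm_monom_degree m = d"
  shows "h p \<in> V d"
proof -
  have sum: "sum f S \<in> V i" if "\<And>m. m \<in> S \<Longrightarrow> f m \<in> V i" for f i and S :: "('a fm_gen \<Rightarrow>\<^sub>0 nat) set"
    using that by (induction S rule: infinite_finite_induct) (auto intro: zero add)
  have "h (fm_const (Poly_Mapping.lookup p m)) * eval_monom (\<lambda>g. h (fm_var g)) m \<in> V d"
    if "m \<in> Poly_Mapping.keys p" for m
    using mult[OF const eval_monom_graded[of V "\<lambda>g. h (fm_var g)", OF one mult gen]] p that by fastforce
  then show ?thesis
    unfolding fm_eval_unique[OF h, of p] fm_eval_def by (intro sum)
qed

text \<open>The additive formal module over \<open>A\<close> is classified by a homomorphism to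
  \<open>A\<close> that kills all elements of positive degree, hence all decomposables, but sends
  \<open>1\<close> to \<open>1\<close>.\<close>

lemma one_notin_decomposables: "1 \<notin> (decomposables :: 'a::comm_ring_1 lazard set)"
proof
  assume 1: "(1 :: 'a lazard) \<in> decomposables"
  obtain h :: "'a lazard \<Rightarrow> 'a" where h: "is_ring_hom h" "\<forall>a. h (lazard_of a) = a"
      "fps_map2 h lazard_F = additive_F" "\<forall>a. fps_map h (lazard_rho a) = additive_rho a"
    using lazard_universal[OF _ formal_module_additive] by (auto simp: is_ring_hom_def)
  have ha: "is_ring_hom (\<lambda>p. h (abs_lazard p))"
    using h(1) is_ring_hom_abs_lazard unfolding is_ring_hom_def by metis
  have F: "h (abs_lazard (fm_var (Alpha i j))) = additive_F $ i $ j" for i j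
    unfolding h(3)[symmetric] by (simp add: lazard_F_def generic_F_def)
  have rho: "h (abs_lazard (fm_var (Rho a i))) = additive_rho a $ i" for a i
    unfolding h(4)[rule_format, symmetric] by (simp add: lazard_rho_def generic_rho_def)
  have "h x = 0" if x: "x \<in> lazard_degree i" and i: "i > 0" for x i
  proof -
    obtain p where p: "x = abs_lazard p" "\<forall>m\<in>Poly_Mapping.keys p. fm_monom_degree m = i"
      using x by (auto simp: lazard_degree_def)
    \<comment> \<open>The graded family is everything in degree 0 and \<open>{0}\<close> above it,
      since additive data have no nonzero coefficients of positive degree.\<close>
    have "h (abs_lazard (fm_var g)) \<in> (if fm_gen_degree g = 0 then UNIV else {0})" for g
      by (cases g) (auto simp: F rho additive_F_def additive_rho_def fps_X_def)
    then have "h (abs_lazard p) \<in> (if i = 0 then UNIV else {0})"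
      by (intro ring_hom_graded[OF ha _ _ _ _ _ _ p(2)]) (auto split: if_splits)
    then show ?thesis using i p by simp
  qed
  then have "h 1 = 0"
    by (intro ring_hom_ideal_gen_zero[OF h(1) _ 1[unfolded decomposables_def]])
      (auto simp: ring_hom_mult[OF h(1)])
  then show False by (simp add: ring_hom_1[OF h(1)])
qed

text \<open>With a ring structure, and not only an \<open>A\<close>-module structure, the quotient
  carries the image of the universal formal module. The class axiom \<open>0 \<noteq> 1\<close>
  comes from \<open>one_notin_decomposables\<close>.\<close>

instantiation lazard_indec :: (comm_ring_1) comm_ring_1
begin

lift_definition one_lazard_indec :: "'a lazard_indec" is 1 .

lift_definition times_lazard_indec :: "'a lazard_indec \<Rightarrow> 'a lazard_indec \<Rightarrow> 'a lazard_indec" is "(*)"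
proof -
  fix p p' q q' :: "'a lazard"
  assume "indec_cong p p'" "indec_cong q q'"
  then have "q * (p - p') + p' * (q - q') \<in> decomposables"
    unfolding indec_cong_def by (intro decomposables_add decomposables_mult)
  then show "indec_cong (p * q) (p' * q')"
    by (simp add: indec_cong_def algebra_simps)
qed

instance
proof
  fix a b c :: "'a lazard_indec"
  show "(0 :: 'a lazard_indec) \<noteq> 1"
    by transfer (metis indec_cong_def diff_0 decomposables_neg minus_minus one_notin_decomposables)
  show "a * b * c = a * (b * c)" "a * b = b * a" "1 * a = a" "(a + b) * c = a * c + b * c"
    by (transfer, simp add: indec_cong_def decomposables_0 algebra_simps)+
qed

end

definition indec_of :: "'a::comm_ring_1 \<Rightarrow> 'a lazard_indec" where
  "indec_of a = abs_lazard_indec (lazard_of a)"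

definition indec_F :: "'a::comm_ring_1 lazard_indec fps2" where
  "indec_F = fps_map2 abs_lazard_indec lazard_F"

definition indec_rho :: "'a::comm_ring_1 \<Rightarrow> 'a lazard_indec fps" where
  "indec_rho a = fps_map abs_lazard_indec (lazard_rho a)"

lemma is_ring_hom_abs_indec: "is_ring_hom abs_lazard_indec"
  by (simp add: is_ring_hom_def one_lazard_indec.abs_eq plus_lazard_indec.abs_eq
      times_lazard_indec.abs_eq)

lemma is_ring_hom_indec_of: "is_ring_hom indec_of"
  using is_ring_hom_abs_indec is_ring_hom_lazard_of
  unfolding is_ring_hom_def indec_of_def by metis

lemma indec_scale_eq: "indec_scale a x = indec_of a * x"
  unfolding indec_of_def by transfer (simp add: indec_cong_def decomposables_0)

lemma indec_formal_module: "formal_module indec_of indec_F indec_rho"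
proof -
  have "fm_relations indec_of indec_F indec_rho =
      abs_lazard_indec ` fm_relations lazard_of lazard_F lazard_rho"
    using fm_relations_map[OF is_ring_hom_abs_indec, of lazard_of lazard_F lazard_rho]
    by (simp add: indec_of_def[abs_def] indec_F_def indec_rho_def[abs_def])
  also have "\<dots> \<subseteq> {0}"
    using lazard_formal_module ring_hom_0[OF is_ring_hom_abs_indec]
    by (auto simp: formal_module_iff_relations)
  finally show ?thesis by (simp add: formal_module_iff_relations)
qed

lemma abs_indec_eq_0: "x \<in> decomposables \<Longrightarrow> abs_lazard_indec x = 0"
  by (simp add: zero_lazard_indec.abs_eq lazard_indec.abs_eq_iff indec_cong_def)

lemma indec_degree_mult_eq_0:
  assumes "x \<in> indec_degree i" "y \<in> indec_degree j" "i > 0" "j > 0"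
  shows "x * y = 0"
proof -
  obtain x' y' where "x = abs_lazard_indec x'" "y = abs_lazard_indec y'"
    "x' \<in> lazard_degree i" "y' \<in> lazard_degree j"
    using assms by (auto simp: indec_degree_def)
  moreover from this have "x' * y' \<in> decomposables"
    using assms by (auto simp: decomposables_def intro!: module.span_base[OF module_times])
  ultimately show ?thesis
    by (simp add: abs_indec_eq_0 times_lazard_indec.abs_eq)
qed

fun indec_gen :: "'a::comm_ring_1 fm_gen \<Rightarrow> 'a lazard_indec" where
  "indec_gen (Alpha i j) = indec_F $ i $ j"
| "indec_gen (Rho a i) = indec_rho a $ i"

lemma indec_gen_eq: "indec_gen g = abs_lazard_indec (abs_lazard (fm_var g))"
  by (cases g) (simp_all add: indec_F_def indec_rho_def lazard_F_def generic_F_def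
      lazard_rho_def generic_rho_def)

lemma indec_gen_degree: "indec_gen g \<in> indec_degree (fm_gen_degree g)"
proof -
  have "fm_monom_degree (Poly_Mapping.single g 1) = fm_gen_degree g"
    by (simp add: fm_monom_degree_def)
  then show ?thesis
    by (auto simp: indec_gen_eq indec_degree_def lazard_degree_def fm_var_def intro!: imageI)
qed

lemma subspace_indec_degree: "module.subspace indec_scale (indec_degree d)"
proof (rule module.subspaceI[OF module_indec_scale])
  show "(0 :: 'a lazard_indec) \<in> indec_degree d"
    unfolding indec_degree_def lazard_degree_def zero_lazard_indec.abs_eq zero_lazard.abs_eq
    by (intro imageI) simp
next
  fix x y :: "'a lazard_indec" assume "x \<in> indec_degree d" "y \<in> indec_degree d"
  then obtain p q where x: "x = abs_lazard_indec (abs_lazard p)" and y: "y = abs_lazard_indec (abs_lazard q)"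
    and "\<forall>m\<in>Poly_Mapping.keys p. fm_monom_degree m = d" "\<forall>m\<in>Poly_Mapping.keys q. fm_monom_degree m = d"
    by (auto simp: indec_degree_def lazard_degree_def)
  then have "\<forall>m\<in>Poly_Mapping.keys (p + q). fm_monom_degree m = d"
    using Poly_Mapping.keys_add[of p q] by blast
  then show "x + y \<in> indec_degree d"
    unfolding indec_degree_def lazard_degree_def x y plus_lazard_indec.abs_eq plus_lazard.abs_eq
    by (intro imageI) simp
next
  fix c and x :: "'a lazard_indec" assume "x \<in> indec_degree d"
  then obtain p where x: "x = abs_lazard_indec (abs_lazard p)"
    and p: "\<forall>m\<in>Poly_Mapping.keys p. fm_monom_degree m = d"
    by (auto simp: indec_degree_def lazard_degree_def)
  have "Poly_Mapping.keys (fm_const c * p) \<subseteq> Poly_Mapping.keys p"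
    using keys_mult[of "fm_const c" p] by (auto simp: fm_const_def split: if_splits)
  then have "\<forall>m\<in>Poly_Mapping.keys (fm_const c * p). fm_monom_degree m = d"
    using p by blast
  then show "indec_scale c x \<in> indec_degree d"
    unfolding indec_degree_def lazard_degree_def x indec_scale_eq indec_of_def lazard_of_def
      times_lazard_indec.abs_eq times_lazard.abs_eq
    by (intro imageI) simp
qed

subsection \<open>Formal modules whose higher coefficients have zero products\<close>

lemma fps_of_nat_mult_nth: "(of_nat c * f) $ n = of_nat c * f $ n" for f :: "'r::comm_ring_1 fps"
  by (simp flip: fps_of_nat)

abbreviation fps3_const :: "'r::comm_ring_1 \<Rightarrow> 'r fps3" where
  "fps3_const c \<equiv> fps_const (fps_const (fps_const c))"

lemma mult_delta: "x * (if P then 1 else 0) = (if P then x else 0)" for x :: "'r::comm_ring_1"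
  by simp

lemma monom3_nth: "(Xv ^ i * Yv ^ j * Zv ^ k :: 'r::comm_ring_1 fps3) $ a $ b $ c = (if i = a \<and> j = b \<and> k = c then 1 else 0)"
proof -
  have "(Xv ^ i * Yv ^ j * Zv ^ k :: 'r fps3) = fps_const (fps_const (fps_X ^ k) * fps_X ^ j) * fps_X ^ i"
    by (simp add: Xv_def Yv_def Zv_def fps_const_power mult_ac flip: fps_const_mult)
  then show ?thesis
    by (simp only: fps_mult_right_const_nth fps_mult_left_const_nth fps_nth_fps_const) (auto simp: fps_X_power_nth)
qed

lemma sum_delta2:
  fixes g :: "nat \<Rightarrow> nat \<Rightarrow> 'r::comm_ring_1"
  assumes "i \<le> N" "j \<le> N"
  shows "(\<Sum>m\<le>N. \<Sum>l\<le>N. g m l * (if m = i \<and> l = j then 1 else 0)) = g i j"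
proof -
  have "(\<Sum>m\<le>N. \<Sum>l\<le>N. g m l * (if m = i \<and> l = j then 1 else 0)) =
      (\<Sum>m\<le>N. if m = i then (\<Sum>l\<le>N. if l = j then g i j else 0) else 0)"
    by (intro sum.cong) (auto simp: mult_delta intro!: sum.neutral)
  then show ?thesis using assms by simp
qed

lemma monom3_nth':
  "(Xv ^ i * Zv ^ k) $ a $ b $ c = (if i = a \<and> 0 = b \<and> k = c then 1 else 0)"
  "(Xv ^ i * Yv ^ j) $ a $ b $ c = (if i = a \<and> j = b \<and> 0 = c then 1 else 0)"
  "(Yv ^ j * Zv ^ k) $ a $ b $ c = (if 0 = a \<and> j = b \<and> k = c then 1 else 0)"
  "(Xv ^ i) $ a $ b $ c = (if i = a \<and> 0 = b \<and> 0 = c then 1 else 0)"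
  "(Yv ^ j) $ a $ b $ c = (if 0 = a \<and> j = b \<and> 0 = c then 1 else 0)"
  "(Zv ^ k) $ a $ b $ c = (if 0 = a \<and> 0 = b \<and> k = c then 1 else 0)"
  "Xv $ a $ b $ c = (if 1 = a \<and> 0 = b \<and> 0 = c then 1 else 0)"
  "Yv $ a $ b $ c = (if 0 = a \<and> 1 = b \<and> 0 = c then 1 else 0)"
  "Zv $ a $ b $ c = (if 0 = a \<and> 0 = b \<and> 1 = c then 1 else 0)"
  using monom3_nth[of i 0 k a b c] monom3_nth[of i j 0 a b c] monom3_nth[of 0 j k a b c]
    monom3_nth[of i 0 0 a b c] monom3_nth[of 0 j 0 a b c] monom3_nth[of 0 0 k a b c]
    monom3_nth[of 1 0 0 a b c] monom3_nth[of 0 1 0 a b c] monom3_nth[of 0 0 1 a b c]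
  by (simp_all only: power_0 power_one_right mult_1_left mult_1_right)

lemma binomial_XY_nth:
  "((Xv + Yv) ^ m * Zv ^ l :: 'r::comm_ring_1 fps3) $ i $ j $ k = (if m = i + j \<and> l = k then of_nat (m choose i) else 0)"
proof -
  have "((Xv + Yv) ^ m * Zv ^ l :: 'r fps3) =
      (\<Sum>t\<le>m. of_nat (m choose t) * (Xv ^ t * Yv ^ (m - t) * Zv ^ l))"
    by (simp add: binomial_ring sum_distrib_right mult.assoc)
  then have "((Xv + Yv) ^ m * Zv ^ l :: 'r fps3) $ i $ j $ k =
      (\<Sum>t\<le>m. of_nat (m choose t) * (if t = i \<and> m - t = j \<and> l = k then 1 else 0))"
    by (simp only: fps_sum_nth fps_of_nat_mult_nth monom3_nth)
  also have "\<dots> = (\<Sum>t\<le>m. if t = i then (if m - i = j \<and> l = k then of_nat (m choose i) else 0) else 0)"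
    by (rule sum.cong) auto
  finally show ?thesis by auto
qed

lemma binomial_YZ_nth:
  "(Xv ^ m * (Yv + Zv) ^ l :: 'r::comm_ring_1 fps3) $ i $ j $ k = (if m = i \<and> l = j + k then of_nat (l choose j) else 0)"
proof -
  have "(Xv ^ m * (Yv + Zv) ^ l :: 'r fps3) =
      (\<Sum>t\<le>l. of_nat (l choose t) * (Xv ^ m * Yv ^ t * Zv ^ (l - t)))"
    by (simp add: binomial_ring sum_distrib_left mult.assoc mult.left_commute)
  then have "(Xv ^ m * (Yv + Zv) ^ l :: 'r fps3) $ i $ j $ k =
      (\<Sum>t\<le>l. of_nat (l choose t) * (if m = i \<and> t = j \<and> l - t = k then 1 else 0))"
    by (simp only: fps_sum_nth fps_of_nat_mult_nth monom3_nth)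
  also have "\<dots> = (\<Sum>t\<le>l. if t = j then (if m = i \<and> l - j = k then of_nat (l choose j) else 0) else 0)"
    by (rule sum.cong) auto
  finally show ?thesis by auto
qed

lemma subst2_Xv_Yv_nth: "subst2 F Xv Yv $ i $ j $ k = (if k = 0 then F $ i $ j else 0)"
  using sum_delta2[of i "i + j + k" j "\<lambda>m l. F $ m $ l"]
  by (auto simp: subst2_def monom3_nth' intro!: sum.neutral)

lemma subst2_Yv_Xv_nth: "subst2 F Yv Xv $ i $ j $ k = (if k = 0 then F $ j $ i else 0)"
  using sum_delta2[of j "i + j + k" i "\<lambda>m l. F $ m $ l"]
  by (auto simp: subst2_def monom3_nth' mult.commute[of "Yv ^ _"] conj_commute intro!: sum.neutral)

lemma subst2_Yv_Zv_nth: "subst2 F Yv Zv $ i $ j $ k = (if i = 0 then F $ j $ k else 0)"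
  using sum_delta2[of j "i + j + k" k "\<lambda>m l. F $ m $ l"]
  by (auto simp: subst2_def monom3_nth' intro!: sum.neutral)

lemma subst1_Xv_nth: "subst1 f Xv $ i $ j $ k = (if j = 0 \<and> k = 0 then f $ i else 0)"
  by (simp add: subst1_def monom3_nth' mult_delta)

lemma subst1_Yv_nth: "subst1 f Yv $ i $ j $ k = (if i = 0 \<and> k = 0 then f $ j else 0)"
  by (simp add: subst1_def monom3_nth' mult_delta)

lemma formal_group_law_nth_0:
  assumes "formal_group_law F"
  shows "F $ i $ 0 = (if i = 1 then 1 else 0)" and "F $ 0 $ i = (if i = 1 then 1 else 0)"
proof -
  have 0: "(0::'a fps3) ^ l = (if l = 0 then 1 else 0)" for l
    by (cases l) simp_all
  have "(Xv ^ m * 0 ^ l) $ i $ 0 $ 0 = (if m = i \<and> l = 0 then 1 else (0::'a))" for m l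
    unfolding 0 by (simp add: monom3_nth')
  then have "subst2 F Xv 0 $ i $ 0 $ 0 = F $ i $ 0"
    using sum_delta2[of i i 0 "\<lambda>m l. F $ m $ l"] by (simp only: subst2_def fps_nth_Abs_fps) simp
  then show "F $ i $ 0 = (if i = 1 then 1 else 0)"
    using assms by (auto simp add: formal_group_law_def monom3_nth')
  have "(0 ^ m * Yv ^ l) $ 0 $ i $ 0 = (if m = 0 \<and> l = i then 1 else (0::'a))" for m l
    unfolding 0 by (simp add: monom3_nth')
  then have "subst2 F 0 Yv $ 0 $ i $ 0 = F $ 0 $ i"
    using sum_delta2[of 0 i i "\<lambda>m l. F $ m $ l"] by (simp only: subst2_def fps_nth_Abs_fps) simp
  then show "F $ 0 $ i = (if i = 1 then 1 else 0)"
    using assms by (auto simp add: formal_group_law_def monom3_nth')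
qed

text \<open>The difference \<open>u ^ m - u' ^ m\<close> is a multiple of \<open>u - u'\<close>,
  which \<open>c\<close> annihilates.\<close>

lemma mult_power_cong:
  fixes c u u' :: "'r::comm_ring_1"
  assumes "c * u = c * u'"
  shows "c * u ^ m = c * u' ^ m"
proof (induction m)
  case (Suc m)
  have "c * u ^ Suc m = (c * u) * u ^ m" by (simp add: mult_ac)
  also have "\<dots> = u' * (c * u ^ m)" unfolding assms by (simp add: mult_ac)
  finally show ?case by (simp add: Suc mult_ac)
qed simp

text \<open>
  If the nonlinear coefficients annihilate \<open>u - u'\<close> and \<open>v - v'\<close>, only the linear part of the
  series sees the difference.
\<close>

lemma subst2_nth_cong:
  assumes F: "formal_group_law F"
    and u: "\<And>m l. m > 0 \<Longrightarrow> l > 0 \<Longrightarrow> fps3_const (F $ m $ l) * u = fps3_const (F $ m $ l) * u'"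
    and v: "\<And>m l. m > 0 \<Longrightarrow> l > 0 \<Longrightarrow> fps3_const (F $ m $ l) * v = fps3_const (F $ m $ l) * v'"
    and N: "N = i + j + k" "N > 0"
  shows "subst2 F u v $ i $ j $ k = u $ i $ j $ k + v $ i $ j $ k +
    (\<Sum>m=1..N. \<Sum>l=1..N. F $ m $ l * (u' ^ m * v' ^ l) $ i $ j $ k)"
proof -
  let ?f = "\<lambda>m l. F $ m $ l * (u ^ m * v ^ l) $ i $ j $ k"
  have split: "(\<Sum>m\<le>N. g m) = g 0 + (\<Sum>m=1..N. g m)" for g :: "nat \<Rightarrow> 'a"
    by (simp add: atMost_atLeast0 sum.atLeast_Suc_atMost)
  have lin: "(\<Sum>m=1..N. if m = 1 then x else 0) = x" for x :: 'a
    using N by (simp add: Suc_le_eq)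
  have "?f m l = F $ m $ l * (u' ^ m * v' ^ l) $ i $ j $ k" if "m > 0" "l > 0" for m l
  proof -
    let ?c = "fps3_const (F $ m $ l)"
    have "?c * (u ^ m * v ^ l) = v ^ l * (?c * u ^ m)" by (simp add: mult_ac)
    also have "\<dots> = u' ^ m * (?c * v ^ l)"
      unfolding mult_power_cong[OF u[OF that]] by (simp add: mult_ac)
    also have "\<dots> = ?c * (u' ^ m * v' ^ l)"
      unfolding mult_power_cong[OF v[OF that]] by (simp add: mult_ac)
    finally show ?thesis
      by (metis (no_types, lifting) fps_mult_left_const_nth)
  qed
  then have *: "(\<Sum>m=1..N. \<Sum>l=1..N. ?f m l) =
      (\<Sum>m=1..N. \<Sum>l=1..N. F $ m $ l * (u' ^ m * v' ^ l) $ i $ j $ k)"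
    by (intro sum.cong) auto
  have "subst2 F u v $ i $ j $ k = (\<Sum>m\<le>N. \<Sum>l\<le>N. ?f m l)"
    by (simp add: subst2_def N)
  also have "\<dots> = (?f 0 0 + (\<Sum>l=1..N. ?f 0 l)) + ((\<Sum>m=1..N. ?f m 0) + (\<Sum>m=1..N. \<Sum>l=1..N. ?f m l))"
    unfolding split sum.distrib by (simp only: add_ac)
  also have "(\<Sum>l=1..N. ?f 0 l) = (\<Sum>l=1..N. if l = 1 then v $ i $ j $ k else 0)"
    by (rule sum.cong) (auto simp: formal_group_law_nth_0[OF F])
  also have "(\<Sum>m=1..N. ?f m 0) = (\<Sum>m=1..N. if m = 1 then u $ i $ j $ k else 0)"
    by (rule sum.cong) (auto simp: formal_group_law_nth_0[OF F])
  finally show ?thesis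
    unfolding lin * by (simp add: formal_group_law_nth_0[OF F])
qed

text \<open>All powers of \<open>u\<close> beyond the first carry a coefficient that cannot tell
  \<open>u\<close> from \<open>u'\<close>; the linear term keeps \<open>u\<close> itself.\<close>

lemma subst1_nth_cong:
  assumes f: "f $ 0 = 0"
    and u: "\<And>m. m \<ge> 2 \<Longrightarrow> fps3_const (f $ m) * u = fps3_const (f $ m) * u'"
    and N: "N = i + j + k" "N > 0"
  shows "subst1 f u $ i $ j $ k = f $ 1 * u $ i $ j $ k + (\<Sum>m=2..N. f $ m * (u' ^ m) $ i $ j $ k)"
proof -
  let ?f = "\<lambda>m. f $ m * (u ^ m) $ i $ j $ k"
  have "?f m = f $ m * (u' ^ m) $ i $ j $ k" if "m \<ge> 2" for m
    using mult_power_cong[OF u[OF that], of m] by (metis (no_types, lifting) fps_mult_left_const_nth)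
  then have *: "(\<Sum>m=2..N. ?f m) = (\<Sum>m=2..N. f $ m * (u' ^ m) $ i $ j $ k)"
    by (intro sum.cong) auto
  have "subst1 f u $ i $ j $ k = (\<Sum>m\<le>N. ?f m)"
    by (simp add: subst1_def N)
  also have "\<dots> = ?f 0 + (?f 1 + (\<Sum>m=2..N. ?f m))"
    using N sum.atLeast_Suc_atMost[of 0 N ?f] sum.atLeast_Suc_atMost[of 1 N ?f]
    by (simp only: atMost_atLeast0) (simp add: numeral_2_eq_2 Suc_le_eq)
  finally show ?thesis unfolding * using f by simp
qed

lemma sum_delta2_from_1:
  fixes f :: "nat \<Rightarrow> nat \<Rightarrow> 'b::comm_ring_1"
  assumes "0 < i" "0 < j" "i \<le> N" "j \<le> N"
  shows "(\<Sum>m=1..N. \<Sum>l=1..N. f m l * (if m = i \<and> l = j then x else 0)) = f i j * x"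
proof -
  have "(\<Sum>m=1..N. \<Sum>l=1..N. f m l * (if m = i \<and> l = j then x else 0)) =
      (\<Sum>m=1..N. if m = i then (\<Sum>l=1..N. if l = j then f i j * x else 0) else 0)"
    by (intro sum.cong) (auto intro!: sum.neutral simp: if_distrib[of "(*) _"] cong: if_cong)
  then show ?thesis using assms by simp
qed

lemma fps3_const_power: "fps3_const (c::'r::comm_ring_1) ^ m = fps3_const (c ^ m)"
  by (simp add: fps_const_power)

text \<open>The index bounds select coefficients of positive degree. The coefficients
  \<open>F $ i $ 0\<close> and \<open>F $ 0 $ i\<close> are fixed by the unit axioms of the group
  law instead.\<close>

locale square_zero_formal_module =
  fixes \<phi> :: "'a::comm_ring_1 \<Rightarrow> 'r::comm_ring_1" and F :: "'r fps2" and \<rho> :: "'a \<Rightarrow> 'r fps"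
  assumes formal_module: "formal_module \<phi> F \<rho>"
    and F_F: "0 < i \<Longrightarrow> 0 < j \<Longrightarrow> 0 < k \<Longrightarrow> 0 < l \<Longrightarrow> F $ i $ j * F $ k $ l = 0"
    and F_rho: "0 < i \<Longrightarrow> 0 < j \<Longrightarrow> 2 \<le> m \<Longrightarrow> F $ i $ j * \<rho> a $ m = 0"
    and rho_rho: "2 \<le> m \<Longrightarrow> 2 \<le> l \<Longrightarrow> \<rho> a $ m * \<rho> b $ l = 0"
begin

lemma formal_group_law: "formal_group_law F"
  using formal_module by (simp add: formal_module_def)

lemmas F_nth_0 = formal_group_law_nth_0[OF formal_group_law]

lemma rho_nth_0: "\<rho> a $ 0 = 0" and rho_nth_1: "\<rho> a $ Suc 0 = \<phi> a"
  using formal_module by (auto simp: formal_module_def fgl_End_def)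

text \<open>Up to terms that \<open>c\<close> kills, \<open>F(X,Y)\<close> is \<open>X + Y\<close>.
  This and \<open>annihilate_rho\<close> supply the hypotheses on \<open>u\<close> and
  \<open>v\<close> when the axioms are expanded with \<open>subst2_nth_cong\<close> and
  \<open>subst1_nth_cong\<close>.\<close>

lemma annihilate_F:
  assumes c: "\<And>m l. 0 < m \<Longrightarrow> 0 < l \<Longrightarrow> c * F $ m $ l = 0"
  shows "fps3_const c * subst2 F Xv Yv = fps3_const c * (Xv + Yv)"
    and "fps3_const c * subst2 F Yv Zv = fps3_const c * (Yv + Zv)"
proof -
  have "c * F $ m $ l = c * ((if m = 1 \<and> l = 0 then 1 else 0) + (if m = 0 \<and> l = 1 then 1 else 0))" for m l
    using c[of m l] by (cases "m = 0"; cases "l = 0") (auto simp: F_nth_0)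
  then show "fps3_const c * subst2 F Xv Yv = fps3_const c * (Xv + Yv)"
    and "fps3_const c * subst2 F Yv Zv = fps3_const c * (Yv + Zv)"
    by (auto simp: fps_eq_iff subst2_Xv_Yv_nth subst2_Yv_Zv_nth monom3_nth')
qed

lemma annihilate_rho:
  assumes c: "\<And>m. 2 \<le> m \<Longrightarrow> c * \<rho> a $ m = 0"
  shows "fps3_const c * subst1 (\<rho> a) Xv = fps3_const c * (fps3_const (\<phi> a) * Xv)"
    and "fps3_const c * subst1 (\<rho> a) Yv = fps3_const c * (fps3_const (\<phi> a) * Yv)"
proof -
  have *: "c * \<rho> a $ m = c * (if m = 1 then \<phi> a else 0)" for m
    using c[of m] by (cases "m \<ge> 2") (auto simp: not_le less_2_cases_iff rho_nth_0 rho_nth_1)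
  show "fps3_const c * subst1 (\<rho> a) Xv = fps3_const c * (fps3_const (\<phi> a) * Xv)"
    and "fps3_const c * subst1 (\<rho> a) Yv = fps3_const c * (fps3_const (\<phi> a) * Yv)"
    by (auto simp: fps_eq_iff subst1_Xv_nth subst1_Yv_nth monom3_nth' * simp del: fps_const_mult)
qed

lemma F_commute: "F $ i $ j = F $ j $ i"
proof -
  have "subst2 F Xv Yv $ i $ j $ 0 = subst2 F Yv Xv $ i $ j $ 0"
    using formal_group_law by (simp add: formal_group_law_def)
  then show ?thesis by (simp add: subst2_Xv_Yv_nth subst2_Yv_Xv_nth)
qed

text \<open>This is the coefficient of \<open>X^i Y^j Z^k\<close> in the associativity law. As all
  exponents are positive, the linear terms \<open>F(X,Y) + Z\<close> and \<open>X + F(Y,Z)\<close>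
  contribute nothing, and the inner \<open>F\<close> may be replaced by a sum in the nonlinear
  terms.\<close>

lemma F_cocycle:
  assumes "0 < i" "0 < j" "0 < k"
  shows "of_nat (i + j choose i) * F $ (i + j) $ k = of_nat (j + k choose j) * F $ i $ (j + k)"
proof -
  let ?N = "i + j + k"
  have "subst2 F (subst2 F Xv Yv) Zv $ i $ j $ k =
      (\<Sum>m=1..?N. \<Sum>l=1..?N. F $ m $ l * ((Xv + Yv) ^ m * Zv ^ l) $ i $ j $ k)"
    using assms subst2_nth_cong[OF formal_group_law annihilate_F(1)[OF F_F] refl refl, of i j k]
    by (simp add: subst2_Xv_Yv_nth monom3_nth')
  also have "\<dots> = F $ (i + j) $ k * of_nat (i + j choose i)"
    unfolding binomial_XY_nth using assms sum_delta2_from_1[of "i + j" k ?N "\<lambda>m l. F $ m $ l"]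
    by (simp cong: if_cong)
  finally have L: "subst2 F (subst2 F Xv Yv) Zv $ i $ j $ k = F $ (i + j) $ k * of_nat (i + j choose i)" .
  have "subst2 F Xv (subst2 F Yv Zv) $ i $ j $ k =
      (\<Sum>m=1..?N. \<Sum>l=1..?N. F $ m $ l * (Xv ^ m * (Yv + Zv) ^ l) $ i $ j $ k)"
    using assms subst2_nth_cong[OF formal_group_law refl annihilate_F(2)[OF F_F] refl, of i j k]
    by (simp add: subst2_Yv_Zv_nth monom3_nth')
  also have "\<dots> = F $ i $ (j + k) * of_nat (j + k choose j)"
    unfolding binomial_YZ_nth using assms sum_delta2_from_1[of i "j + k" ?N "\<lambda>m l. F $ m $ l"]
    by (simp cong: if_cong)
  finally have R: "subst2 F Xv (subst2 F Yv Zv) $ i $ j $ k = F $ i $ (j + k) * of_nat (j + k choose j)" .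
  show ?thesis
    using L R formal_group_law unfolding formal_group_law_def by (metis mult.commute)
qed

text \<open>Compare coefficients of \<open>X^i Y^j\<close> in the endomorphism identity. On the
  left, the linear term of \<open>\<rho> a\<close> meets \<open>F\<close> and its term of degree
  \<open>i + j\<close> meets a power of \<open>X + Y\<close>; on the right, \<open>\<phi> a\<close>
  is substituted into both variables.\<close>

lemma rho_endo:
  assumes "0 < i" "0 < j"
  shows "\<phi> a * F $ i $ j + of_nat (i + j choose i) * \<rho> a $ (i + j) = \<phi> a ^ (i + j) * F $ i $ j"
proof -
  let ?N = "i + j + 0"
  have F_rho': "\<rho> a $ m * F $ k $ l = 0" if "2 \<le> m" "0 < k" "0 < l" for m k l
    using F_rho[OF that(2,3,1)] by (simp add: mult.commute)
  have "subst1 (\<rho> a) (subst2 F Xv Yv) $ i $ j $ 0 =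
      \<phi> a * F $ i $ j + (\<Sum>m=2..?N. \<rho> a $ m * ((Xv + Yv) ^ m * Zv ^ 0) $ i $ j $ 0)"
    using assms subst1_nth_cong[OF rho_nth_0 annihilate_F(1)[OF F_rho'] refl, of i j 0]
    by (simp add: subst2_Xv_Yv_nth monom3_nth' rho_nth_1)
  also have "(\<Sum>m=2..?N. \<rho> a $ m * ((Xv + Yv) ^ m * Zv ^ 0) $ i $ j $ 0) =
      (\<Sum>m=2..?N. if m = ?N then \<rho> a $ ?N * of_nat (?N choose i) else 0)"
    unfolding binomial_XY_nth by (rule sum.cong) auto
  also have "\<dots> = \<rho> a $ ?N * of_nat (?N choose i)"
    using assms by simp
  finally have L: "subst1 (\<rho> a) (subst2 F Xv Yv) $ i $ j $ 0 =
      \<phi> a * F $ i $ j + \<rho> a $ ?N * of_nat (?N choose i)" .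
  have mono: "(fps3_const (\<phi> a) * Xv) ^ m * (fps3_const (\<phi> a) * Yv) ^ l =
      fps3_const (\<phi> a ^ (m + l)) * (Xv ^ m * Yv ^ l)" for m l
    by (simp only: power_mult_distrib fps3_const_power power_add fps_const_mult[symmetric] mult_ac)
  have "subst2 F (subst1 (\<rho> a) Xv) (subst1 (\<rho> a) Yv) $ i $ j $ 0 =
      (\<Sum>m=1..?N. \<Sum>l=1..?N. F $ m $ l *
        ((fps3_const (\<phi> a) * Xv) ^ m * (fps3_const (\<phi> a) * Yv) ^ l) $ i $ j $ 0)"
    using assms subst2_nth_cong[OF formal_group_law annihilate_rho(1)[OF F_rho]
        annihilate_rho(2)[OF F_rho] refl, of i j 0 a a]
    by (simp add: subst1_Xv_nth subst1_Yv_nth)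
  also have "\<dots> = (\<Sum>m=1..?N. \<Sum>l=1..?N. F $ m $ l * (if m = i \<and> l = j then \<phi> a ^ (i + j) else 0))"
    unfolding mono by (intro sum.cong refl) (simp add: monom3_nth')
  also have "\<dots> = F $ i $ j * \<phi> a ^ (i + j)"
    using assms by (intro sum_delta2_from_1) auto
  finally have "subst2 F (subst1 (\<rho> a) Xv) (subst1 (\<rho> a) Yv) $ i $ j $ 0 = F $ i $ j * \<phi> a ^ (i + j)" .
  moreover have "subst1 (\<rho> a) (subst2 F Xv Yv) = subst2 F (subst1 (\<rho> a) Xv) (subst1 (\<rho> a) Yv)"
    using formal_module by (simp add: formal_module_def fgl_End_def)
  ultimately show ?thesis
    using L by (simp add: mult.commute)
qed

lemma rho_add:
  assumes "2 \<le> n"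
  shows "\<rho> (a + b) $ n = \<rho> a $ n + \<rho> b $ n + (\<Sum>i\<in>{0<..<n}. \<phi> a ^ i * \<phi> b ^ (n - i) * F $ i $ (n - i))"
proof -
  have mono: "(fps3_const (\<phi> a) * Xv) ^ m * (fps3_const (\<phi> b) * Xv) ^ l =
      fps3_const (\<phi> a ^ m * \<phi> b ^ l) * Xv ^ (m + l)" for m l
    by (simp only: power_mult_distrib fps3_const_power power_add fps_const_mult[symmetric] mult_ac)
  have "subst2 F (subst1 (\<rho> a) Xv) (subst1 (\<rho> b) Xv) $ n $ 0 $ 0 = \<rho> a $ n + \<rho> b $ n +
      (\<Sum>m=1..n. \<Sum>l=1..n. F $ m $ l *
        ((fps3_const (\<phi> a) * Xv) ^ m * (fps3_const (\<phi> b) * Xv) ^ l) $ n $ 0 $ 0)"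
    using assms subst2_nth_cong[OF formal_group_law annihilate_rho(1)[OF F_rho]
        annihilate_rho(1)[OF F_rho] refl, of n 0 0 a b]
    by (simp add: subst1_Xv_nth)
  also have "(\<Sum>m=1..n. \<Sum>l=1..n. F $ m $ l *
        ((fps3_const (\<phi> a) * Xv) ^ m * (fps3_const (\<phi> b) * Xv) ^ l) $ n $ 0 $ 0) =
      (\<Sum>m=1..n. \<Sum>l=1..n. if l = n - m then \<phi> a ^ m * \<phi> b ^ (n - m) * F $ m $ (n - m) else 0)"
    unfolding mono by (intro sum.cong refl) (auto simp: monom3_nth')
  also have "\<dots> = (\<Sum>m=1..n. if m < n then \<phi> a ^ m * \<phi> b ^ (n - m) * F $ m $ (n - m) else 0)"
    by (intro sum.cong refl) auto
  also have "\<dots> = (\<Sum>m\<in>{0<..<n}. \<phi> a ^ m * \<phi> b ^ (n - m) * F $ m $ (n - m))"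
    by (rule sum.mono_neutral_cong_right) auto
  finally have "subst2 F (subst1 (\<rho> a) Xv) (subst1 (\<rho> b) Xv) $ n $ 0 $ 0 =
      \<rho> a $ n + \<rho> b $ n + (\<Sum>i\<in>{0<..<n}. \<phi> a ^ i * \<phi> b ^ (n - i) * F $ i $ (n - i))" .
  moreover have "subst1 (\<rho> (a + b)) Xv = subst2 F (subst1 (\<rho> a) Xv) (subst1 (\<rho> b) Xv)"
    using formal_module by (simp add: formal_module_def)
  moreover have "subst1 (\<rho> (a + b)) Xv $ n $ 0 $ 0 = \<rho> (a + b) $ n"
    by (simp add: subst1_Xv_nth)
  ultimately show ?thesis by simp
qed

text \<open>In the composite, the linear term of \<open>\<rho> a\<close> sees all of
  \<open>\<rho> b\<close>, but a higher term sees only the linear part \<open>\<phi> b * X\<close>,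
  so that just the term of index \<open>n\<close> contributes.\<close>

lemma rho_mult:
  assumes "2 \<le> n"
  shows "\<rho> (a * b) $ n = \<phi> a * \<rho> b $ n + \<phi> b ^ n * \<rho> a $ n"
proof -
  have b: "fps_const (\<rho> a $ m) * \<rho> b = fps_const (\<rho> a $ m) * (fps_const (\<phi> b) * fps_X)" if "2 \<le> m" for m
  proof (rule fps_ext)
    fix i show "(fps_const (\<rho> a $ m) * \<rho> b) $ i = (fps_const (\<rho> a $ m) * (fps_const (\<phi> b) * fps_X)) $ i"
      using rho_rho[OF that, of i a b]
      by (cases "i \<ge> 2") (auto simp: not_le less_2_cases_iff rho_nth_0 rho_nth_1 mult.assoc simp del: fps_const_mult)
  qed
  have *: "\<rho> a $ m * (\<rho> b ^ m) $ n = (if m = n then \<phi> b ^ n * \<rho> a $ n else 0)" if "2 \<le> m" for m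
  proof -
    have "fps_const (\<rho> a $ m) * \<rho> b ^ m = fps_const (\<rho> a $ m) * (fps_const (\<phi> b ^ m) * fps_X ^ m)"
      using mult_power_cong[OF b[OF that], of m] by (simp only: power_mult_distrib fps_const_power)
    then have "(fps_const (\<rho> a $ m) * \<rho> b ^ m) $ n = (fps_const (\<rho> a $ m) * (fps_const (\<phi> b ^ m) * fps_X ^ m)) $ n"
      by simp
    then show ?thesis
      by (auto simp: fps_X_power_nth mult.commute simp del: fps_const_mult)
  qed
  have "\<rho> (a * b) $ n = (\<Sum>m=0..n. \<rho> a $ m * (\<rho> b ^ m) $ n)"
    using formal_module by (simp add: formal_module_def fps_compose_nth)
  also have "\<dots> = \<phi> a * \<rho> b $ n + (\<Sum>m=2..n. \<rho> a $ m * (\<rho> b ^ m) $ n)"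
    using assms by (simp add: sum.atLeast_Suc_atMost rho_nth_0 rho_nth_1 numeral_2_eq_2)
  also have "(\<Sum>m=2..n. \<rho> a $ m * (\<rho> b ^ m) $ n) = (\<Sum>m=2..n. if m = n then \<phi> b ^ n * \<rho> a $ n else 0)"
    by (rule sum.cong) (auto simp: *)
  finally show ?thesis using assms by simp
qed

end

section \<open>The graded pieces of the indecomposables as spans of coefficients\<close>

lemma indec_F_degree: "indec_F $ i $ j \<in> indec_degree (2 * (i + j - 1))"
  and indec_rho_degree: "indec_rho a $ i \<in> indec_degree (2 * (i - 1))"
  using indec_gen_degree[of "Alpha i j"] indec_gen_degree[of "Rho a i"] by simp_all

interpretation indec: square_zero_formal_module indec_of indec_F indec_rho
  by standard
     (simp_all add: indec_formal_module indec_degree_mult_eq_0[OF indec_F_degree indec_F_degree]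
      indec_degree_mult_eq_0[OF indec_F_degree indec_rho_degree]
      indec_degree_mult_eq_0[OF indec_rho_degree indec_rho_degree])

interpretation indec_module: Modules.module indec_scale
  by (rule module_indec_scale)

text \<open>Truncated subtraction puts \<open>Alpha 0 0\<close> and \<open>Rho a 0\<close> in degree
  0 as well, but these map to 0; the other generators of degree 0 map to \<open>1\<close> or to some
  \<open>indec_of a\<close>.\<close>

lemma indec_gen_degree_0:
  assumes "fm_gen_degree g = 0"
  shows "indec_gen g \<in> range indec_of"
proof -
  have 0: "0 \<in> range (indec_of :: 'a \<Rightarrow> _)" and 1: "1 \<in> range (indec_of :: 'a \<Rightarrow> _)"
    by (rule range_eqI[of _ _ 0], simp add: ring_hom_0[OF is_ring_hom_indec_of])
      (rule range_eqI[of _ _ 1], simp add: ring_hom_1[OF is_ring_hom_indec_of])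
  show ?thesis
  proof (cases g)
    case (Alpha i j)
    then have "i = 0 \<or> j = 0" using assms by auto
    then show ?thesis using Alpha 0 1 by (auto simp: indec.F_nth_0)
  next
    case (Rho a i)
    then have "i = 0 \<or> i = Suc 0" using assms by auto
    then show ?thesis using Rho 0 by (auto simp: indec.rho_nth_0 indec.rho_nth_1)
  qed
qed

text \<open>
  Since products of elements of positive degree vanish, the spaces below are closed under
  multiplication, so they contain the images of all homogeneous polynomials.
\<close>

definition indec_part :: "nat \<Rightarrow> 'a::comm_ring_1 lazard_indec set" where
  "indec_part d = (if d = 0 then range indec_of
     else module.span indec_scale (indec_gen ` {g. fm_gen_degree g = d}))"

lemma indec_part_subset: "d > 0 \<Longrightarrow> indec_part d \<subseteq> indec_degree d"
  using indec_module.span_minimal[OF _ subspace_indec_degree, of "indec_gen ` {g. fm_gen_degree g = d}" d]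
    indec_gen_degree
  by (fastforce simp: indec_part_def)

lemma indec_degree_subset: "indec_degree d \<subseteq> indec_part d"
proof
  fix x :: "'a lazard_indec" assume "x \<in> indec_degree d"
  then obtain p where p: "x = abs_lazard_indec (abs_lazard p)"
      "\<forall>m\<in>Poly_Mapping.keys p. fm_monom_degree m = d"
    by (auto simp: indec_degree_def lazard_degree_def)
  have hom: "is_ring_hom (\<lambda>p. abs_lazard_indec (abs_lazard p))"
    using is_ring_hom_abs_indec is_ring_hom_abs_lazard unfolding is_ring_hom_def by metis
  note indec_hom = ring_hom_0[OF is_ring_hom_indec_of] ring_hom_1[OF is_ring_hom_indec_of]
    ring_hom_add[OF is_ring_hom_indec_of] ring_hom_mult[OF is_ring_hom_indec_of]
  have scale: "indec_of a * x \<in> indec_part i" if "x \<in> indec_part i" for a i and x :: "'a lazard_indec"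
    using that indec_module.span_scale[of x "indec_gen ` {g. fm_gen_degree g = i}" a]
    by (auto simp: indec_part_def indec_scale_eq simp flip: indec_hom(4))
  have mult: "x * y \<in> indec_part (i + j)"
    if "x \<in> indec_part i" "y \<in> indec_part j" for i j and x y :: "'a lazard_indec"
  proof (cases "i = 0 \<or> j = 0")
    case True
    then show ?thesis
    proof
      assume "i = 0" then show ?thesis using that scale[of y j] by (auto simp: indec_part_def)
    next
      assume "j = 0" then show ?thesis using that scale[of x i] by (auto simp: indec_part_def mult.commute)
    qed
  next
    case False
    then have "x * y = 0"
      using that indec_part_subset by (intro indec_degree_mult_eq_0[of _ i _ j]) auto
    then show ?thesis using False by (simp add: indec_part_def indec_module.span_zero)
  qed
  show "x \<in> indec_part d"
    unfolding p(1)
  proof (rule ring_hom_graded[where V = indec_part, OF hom _ mult _ _ _ _ p(2)])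
    show "1 \<in> (indec_part 0 :: 'a lazard_indec set)"
      using indec_hom(2) by (auto simp: indec_part_def intro: range_eqI[of _ _ 1])
    show "abs_lazard_indec (abs_lazard (fm_var g)) \<in> indec_part (fm_gen_degree g)" for g :: "'a fm_gen"
      unfolding indec_gen_eq[symmetric]
      by (auto simp: indec_part_def indec_gen_degree_0 intro!: indec_module.span_base)
    show "0 \<in> (indec_part i :: 'a lazard_indec set)" for i
      by (simp add: indec_part_def indec_module.span_zero) (auto simp: indec_hom intro: range_eqI[of _ _ 0])
    show "x + y \<in> indec_part i" if "x \<in> indec_part i" "y \<in> indec_part i" for i and x y :: "'a lazard_indec"
      using that by (auto simp: indec_part_def indec_module.span_add simp flip: indec_hom(3))
    show "abs_lazard_indec (abs_lazard (fm_const a)) \<in> indec_part 0" for a :: 'a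
      by (simp add: indec_part_def indec_of_def lazard_of_def)
  qed
qed

lemma indec_degree_0: "indec_degree 0 = module.span indec_scale {1 :: 'a::comm_ring_1 lazard_indec}"
proof
  show "indec_degree 0 \<subseteq> module.span indec_scale {1 :: 'a lazard_indec}"
    using indec_degree_subset[of 0]
    by (auto simp: indec_part_def indec_module.span_singleton indec_scale_eq)
  \<comment> \<open>The unit is the coefficient of \<open>X\<close> in the group law, which makes it
    visibly homogeneous of degree 0.\<close>
  have "(1 :: 'a lazard_indec) = indec_gen (Alpha 1 0)"
    by (simp add: indec.F_nth_0)
  then have "(1 :: 'a lazard_indec) \<in> indec_degree 0"
    using indec_gen_degree[of "Alpha 1 0 :: 'a fm_gen"] by simp
  then show "module.span indec_scale {1 :: 'a lazard_indec} \<subseteq> indec_degree 0"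
    by (intro indec_module.span_minimal subspace_indec_degree) auto
qed

text \<open>The generators of this degree are \<open>Alpha i j\<close> with \<open>i + j = n\<close>
  and \<open>Rho a n\<close>. Those with \<open>i = 0\<close> or \<open>j = 0\<close> drop out by
  the unit axioms because \<open>n \<ge> 2\<close>.\<close>

lemma indec_degree_eq_span:
  assumes "n \<ge> 2"
  shows "indec_degree (2 * n - 2) = module.span indec_scale
    ((\<lambda>i. indec_F $ i $ (n - i)) ` {0<..<n} \<union> range (\<lambda>a::'a::comm_ring_1. indec_rho a $ n))"
proof -
  let ?T = "(\<lambda>i. indec_F $ i $ (n - i)) ` {0<..<n} \<union> range (\<lambda>a::'a. indec_rho a $ n)"
  have "indec_degree (2 * n - 2) =
      module.span indec_scale (indec_gen ` {g :: 'a fm_gen. fm_gen_degree g = 2 * n - 2})"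
    using indec_degree_subset[of "2 * n - 2"] indec_part_subset[of "2 * n - 2"] assms
    by (auto simp: indec_part_def)
  also have "\<dots> = module.span indec_scale ?T"
  proof (intro equalityI indec_module.span_minimal indec_module.subspace_span image_subsetI)
    fix g :: "'a fm_gen" assume "g \<in> {g. fm_gen_degree g = 2 * n - 2}"
    then have g: "fm_gen_degree g = 2 * n - 2" by simp
    show "indec_gen g \<in> module.span indec_scale ?T"
    proof (cases g)
      case (Alpha i j)
      then have ij: "i + j = n" using g assms by simp
      show ?thesis
      proof (cases "i = 0 \<or> j = 0")
        case True
        then show ?thesis using Alpha ij assms by (auto simp: indec.F_nth_0 indec_module.span_zero)
      next
        case False
        then have "indec_gen g \<in> (\<lambda>i. indec_F $ i $ (n - i)) ` {0<..<n}"
          using ij Alpha by (intro image_eqI[of _ _ i]) auto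
        then show ?thesis by (intro indec_module.span_base) blast
      qed
    next
      case (Rho a i)
      then have "i = n" using g assms by simp
      then show ?thesis using Rho by (intro indec_module.span_base) auto
    qed
  next
    have "indec_F $ i $ (n - i) \<in> indec_gen ` {g :: 'a fm_gen. fm_gen_degree g = 2 * n - 2}"
      if "i \<in> {0<..<n}" for i
      using that by (intro image_eqI[of _ _ "Alpha i (n - i)"]) auto
    moreover have "indec_rho a $ n \<in> indec_gen ` {g :: 'a fm_gen. fm_gen_degree g = 2 * n - 2}" for a
      by (intro image_eqI[of _ _ "Rho a n"]) auto
    ultimately show "?T \<subseteq> module.span indec_scale (indec_gen ` {g :: 'a fm_gen. fm_gen_degree g = 2 * n - 2})"
      by (auto intro!: indec_module.span_base)
  qed
  finally show ?thesis .
qed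

subsection \<open>Binomial coefficients prime to \<open>p\<close>\<close>

text \<open>A case of Lucas's theorem. The binomial coefficient is the product of the quotients
  \<open>(u * p ^ t + i) / i\<close> for \<open>0 < i \<le> r\<close>, and since
  \<open>i < p ^ t\<close>, numerator and denominator contain \<open>p\<close> to the same
  power.\<close>

lemma not_dvd_choose_mod:
  assumes p: "prime p" and r: "r < p ^ t"
  shows "\<not> p dvd (u * p ^ t + r choose r)"
proof (cases "u = 0")
  case True
  then show ?thesis using p prime_gt_1_nat[of p] by simp
next
  case False
  have "multiplicity p (u * p ^ t + i) = multiplicity p i" if "0 < i" "i < p ^ t" for i
  proof (rule multiplicity_cong)
    fix s
    show "p ^ s dvd u * p ^ t + i \<longleftrightarrow> p ^ s dvd i"
    proof (cases "s \<le> t")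
      case True
      then have "p ^ s dvd u * p ^ t" by (simp add: le_imp_power_dvd)
      then show ?thesis by (rule dvd_add_right_iff)
    next
      case False
      then have "p ^ t dvd p ^ s" by (simp add: le_imp_power_dvd)
      moreover have "\<not> p ^ t dvd i" using that by (auto dest: dvd_imp_le)
      moreover have "p ^ t dvd u * p ^ t" by simp
      ultimately show ?thesis by (meson dvd_add_right_iff dvd_trans)
    qed
  qed
  note eq = this
  have "multiplicity p (u * p ^ t + (p ^ t - j)) = multiplicity p (p ^ t - j)" if "0 < j" "j < p ^ t" for j
    using that by (intro eq) auto
  then have "multiplicity p (u * p ^ t + r choose r) = 0"
    using p r by (intro p_not_div_choose[of r "p ^ t"]) simp_all
  moreover have "(u * p ^ t + r choose r) \<noteq> 0" by simp
  ultimately show ?thesis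
    using prime_elem_multiplicity_eq_zero_iff prime_imp_prime_elem[OF p] by metis
qed

text \<open>Write \<open>m = a * p ^ t + b\<close> with leading digit \<open>0 < a < p\<close>.
  Modulo \<open>p\<close> the coefficient is \<open>a\<close> by Lucas; here it is instead shown to
  divide a product of two numbers prime to \<open>p\<close>.\<close>

lemma not_dvd_choose_power:
  assumes p: "prime p" and m: "p ^ t \<le> m" "m < p ^ Suc t"
  shows "\<not> p dvd (m choose p ^ t)"
proof
  assume dvd: "p dvd (m choose p ^ t)"
  let ?P = "p ^ t"
  define a b where "a = m div ?P" and "b = m mod ?P"
  have P: "?P > 0" using p by (simp add: prime_gt_0_nat)
  have b: "b < ?P" and mab: "m = a * ?P + b"
    using P div_mult_mod_eq[of m ?P] by (simp_all add: a_def b_def)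
  have a: "0 < a" "a < p"
    using m P by (auto simp: a_def div_greater_zero_iff less_mult_imp_div_less mult.commute)
  \<comment> \<open>Choosing disjoint subsets of sizes \<open>b\<close> and \<open>?P\<close> in
    either order gives \<open>(m choose ?P) * (m - ?P choose b) = (m choose b) * (m - b choose
    ?P)\<close>, where \<open>m - b = a * ?P\<close>.\<close>
  have "(m choose (b + ?P)) * ((b + ?P) choose b) = (m choose b) * ((m - b) choose ?P)"
    using choose_mult[of b "b + ?P" m] a mab by (cases a) auto
  moreover have "(m choose (b + ?P)) * ((b + ?P) choose ?P) = (m choose ?P) * ((m - ?P) choose b)"
    using choose_mult[of ?P "b + ?P" m] a mab by (cases a) auto
  moreover have "((b + ?P) choose b) = ((b + ?P) choose ?P)"
    using binomial_symmetric[of b "b + ?P"] by simp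
  ultimately have "p dvd (m choose b) * ((m - b) choose ?P)"
    using dvd by (metis dvd_mult2)
  then have "p dvd (m choose b) \<or> p dvd (?P * a choose ?P)"
    using p mab by (auto simp: prime_dvd_mult_iff mult.commute)
  moreover have "\<not> p dvd (m choose b)"
    unfolding mab by (rule not_dvd_choose_mod[OF p b])
  moreover have "\<not> p dvd (?P * a choose ?P)"
  proof -
    have "multiplicity p (?P * a choose ?P) = 0"
      using a p by (simp add: const_p_fac not_dvd_imp_multiplicity_0 nat_dvd_not_less)
    moreover have "(?P * a choose ?P) \<noteq> 0" using a by simp
    ultimately show ?thesis
      using prime_elem_multiplicity_eq_zero_iff prime_imp_prime_elem[OF p] by metis
  qed
  ultimately show False by blast
qed

subsection \<open>Local rings\<close>

text \<open>A nonunit generates an ideal avoiding \<open>1\<close>. By Zorn's lemma this lies in a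
  maximal ideal, which can only be \<open>M\<close>.\<close>

lemma local_ring_unit:
  assumes M: "local_ring M" and x: "x \<notin> M"
  obtains y where "y * x = (1::'a::comm_ring_1)"
proof (rule ccontr)
  assume "\<not> thesis"
  then have nu: "y * x \<noteq> 1" for y using that by blast
  interpret ring_module: Modules.module "(*) :: 'a \<Rightarrow> 'a \<Rightarrow> 'a" by (rule module_times)
  let ?A = "{J :: 'a set. is_ideal J \<and> x \<in> J \<and> 1 \<notin> J}"
  have "ideal_gen {x} \<in> ?A"
    using nu ring_module.subspace_span[of "{x}"]
    by (auto simp: ring_module.span_singleton intro: range_eqI[of _ _ 1] dest: sym)
  then have "\<exists>J\<in>?A. \<forall>X\<in>?A. J \<subseteq> X \<longrightarrow> X = J"
  proof (intro subset_Zorn_nonempty)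
    fix C assume C: "C \<noteq> {}" "subset.chain ?A C"
    then have CA: "C \<subseteq> ?A" and lin: "\<And>X Y. X \<in> C \<Longrightarrow> Y \<in> C \<Longrightarrow> X \<subseteq> Y \<or> Y \<subseteq> X"
      by (auto simp: subset_chain_def)
    have "is_ideal (\<Union>C)"
    proof (rule ring_module.subspaceI)
      show "0 \<in> \<Union>C" using C(1) CA ring_module.subspace_0 by fastforce
      show "y + z \<in> \<Union>C" if yz: "y \<in> \<Union>C" "z \<in> \<Union>C" for y z
      proof -
        obtain Y Z where "y \<in> Y" "z \<in> Z" "Y \<in> C" "Z \<in> C" using yz by blast
        then obtain X where "X \<in> C" "y \<in> X" "z \<in> X" using lin[of Y Z] by blast
        then have "y + z \<in> X" using CA ring_module.subspace_add by auto
        then show ?thesis using \<open>X \<in> C\<close> by blast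
      qed
      show "c * y \<in> \<Union>C" if "y \<in> \<Union>C" for c y
        using that CA ring_module.subspace_scale by blast
    qed
    then show "\<Union>C \<in> ?A" using C(1) CA by blast
  qed blast
  then obtain J where J: "J \<in> ?A" "\<And>X. X \<in> ?A \<Longrightarrow> J \<subseteq> X \<Longrightarrow> X = J" by blast
  have "maximal_ideal J"
    unfolding maximal_ideal_def
  proof (intro conjI allI impI)
    fix K assume K: "is_ideal K \<and> J \<subseteq> K"
    show "K = J \<or> K = UNIV"
    proof (cases "1 \<in> K")
      case True
      then have "z \<in> K" for z using ring_module.subspace_scale[of K 1 z] K by simp
      then show ?thesis by blast
    next
      case False
      then show ?thesis using J K by auto
    qed
  qed (use J in auto)
  then show False using M J(1) x by (auto simp: local_ring_def)
qed

locale local_comm_ring =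
  fixes M :: "'a::comm_ring_1 set"
  assumes local: "local_ring M"
begin

lemma maximal: "maximal_ideal M"
  using local by (simp add: local_ring_def)

lemma ideal_M: "is_ideal M" and one_notin: "1 \<notin> M"
proof -
  show M: "is_ideal M" using maximal by (simp add: maximal_ideal_def)
  show "1 \<notin> M"
  proof
    assume "1 \<in> M"
    then have "z \<in> M" for z using module.subspace_scale[OF module_times M, of 1 z] by simp
    then show False using maximal by (auto simp: maximal_ideal_def)
  qed
qed

lemmas zero_in = module.subspace_0[OF module_times ideal_M]
  and add_in = module.subspace_add[OF module_times ideal_M]
  and diff_in = module.subspace_diff[OF module_times ideal_M]
  and neg_in = module.subspace_neg[OF module_times ideal_M]
  and mult_in = module.subspace_scale[OF module_times ideal_M]

lemma mult_in': "x \<in> M \<Longrightarrow> x * y \<in> M"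
  using mult_in[of x y] by (simp add: mult.commute)

lemma prime_M: "x * y \<in> M \<Longrightarrow> x \<in> M \<or> y \<in> M"
proof (rule disjCI)
  assume xy: "x * y \<in> M" and "y \<notin> M"
  then obtain z where "z * y = 1" using local_ring_unit[OF local] by blast
  then have "x = z * (x * y)" by (metis mult.left_commute mult.right_neutral)
  then show "x \<in> M" using xy mult_in by metis
qed

lemma one_diff_notin: "x \<in> M \<Longrightarrow> 1 - x \<notin> M"
  using add_in[of x "1 - x"] one_notin by auto

lemma power_in: "x \<in> M \<Longrightarrow> k > 0 \<Longrightarrow> x ^ k \<in> M"
  by (cases k) (auto simp: mult_in')

text \<open>
  In residue characteristic \<open>0\<close> any prime number qualifies.
\<close>

lemma residue_prime:
  obtains p :: nat where "prime p" "\<And>k. \<not> p dvd k \<Longrightarrow> of_nat k \<notin> M"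
proof (cases "\<exists>p. prime p \<and> of_nat p \<in> M")
  case True
  then obtain p :: nat where p: "prime p" "of_nat p \<in> M" by blast
  have "of_nat k \<notin> M" if "\<not> p dvd k" for k
  proof
    assume k: "of_nat k \<in> M"
    have "coprime (int k) (int p)"
      using p that by (metis coprime_commute coprime_int_iff prime_imp_coprime)
    then obtain x y where "x * int k + y * int p = 1"
      by (metis bezout_int coprime_imp_gcd_eq_1)
    then have "of_int x * of_nat k + of_int y * of_nat p = (1::'a)"
      by (metis of_int_1 of_int_add of_int_mult of_int_of_nat_eq)
    then show False
      using add_in[OF mult_in[OF k] mult_in[OF p(2)]] one_notin by metis
  qed
  then show thesis using that p by blast
next
  case False
  have "of_nat k \<notin> M" if "k > 0" for k :: nat
    using that
  proof (induction k rule: less_induct)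
    case (less k)
    show ?case
    proof (cases "k = 1")
      case True
      then show ?thesis using one_notin by simp
    next
      case False
      then obtain p l where pl: "prime p" "k = p * l" by (meson dvdE prime_factor_nat)
      then have "l < k" "l > 0" using less.prems prime_gt_1_nat[of p] by auto
      then have "of_nat l \<notin> M" by (rule less.IH)
      then show ?thesis
        using pl prime_M[of "of_nat p" "of_nat l"] \<open>\<not> (\<exists>p. prime p \<and> of_nat p \<in> M)\<close> by auto
    qed
  qed
  then show thesis using that[of 2] by (metis dvd_0_right gr0I two_is_prime_nat)
qed

end

subsection \<open>Modules with Drinfeld's relations over a local ring\<close>

text \<open>Here \<open>f i\<close> models the coefficient of \<open>X^i Y^(n-i)\<close> and
  \<open>c a\<close> that of \<open>X^n\<close> in the action of \<open>a\<close>. With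
  \<open>m = i + j\<close>, \<open>f_cocycle\<close> is the relation obtained from
  associativity.\<close>

locale drinfeld_module = local_comm_ring M + Modules.module scale
  for M :: "'a::comm_ring_1 set"
    and scale :: "'a \<Rightarrow> 'b::ab_group_add \<Rightarrow> 'b" (infixr "*s" 75) +
  fixes n :: nat and f :: "nat \<Rightarrow> 'b" and c :: "'a \<Rightarrow> 'b"
  assumes n: "n \<ge> 2"
    and f_symmetric: "0 < i \<Longrightarrow> i < n \<Longrightarrow> f (n - i) = f i"
    and f_cocycle: "0 < i \<Longrightarrow> i < m \<Longrightarrow> m < n \<Longrightarrow>
      of_nat (m choose i) *s f m = of_nat (n - i choose (m - i)) *s f i"
    and c_f: "0 < i \<Longrightarrow> i < n \<Longrightarrow> of_nat (n choose i) *s c a = (a ^ n - a) *s f i"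
    and c_add: "c (a + b) = c a + c b + (\<Sum>i\<in>{0<..<n}. (a ^ i * b ^ (n - i)) *s f i)"
    and c_mult: "c (a * b) = a *s c b + b ^ n *s c a"
begin

abbreviation generated :: "'b set" where
  "generated \<equiv> span (f ` {0<..<n} \<union> range c)"

lemma unit_scale_cancel:
  assumes "u \<notin> M" "u *s x \<in> span T"
  shows "x \<in> span T"
proof -
  obtain y where "y * u = 1" using local_ring_unit[OF local assms(1)] .
  then have "x = y *s (u *s x)" by simp
  then show ?thesis using assms(2) span_scale by metis
qed

text \<open>Expand \<open>c (a * b) = c (b * a)\<close> by \<open>c_mult\<close> in both
  orders.\<close>

lemma c_commute: "(a ^ n - a) *s c b = (b ^ n - b) *s c a"
  using c_mult[of a b] c_mult[of b a]
  by (simp add: mult.commute scale_left_diff_distrib algebra_simps)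

lemma generated_eqI:
  assumes "\<And>m. 0 < m \<Longrightarrow> m < n \<Longrightarrow> f m \<in> span T" "\<And>a. c a \<in> span T" "T \<subseteq> generated"
  shows "span T = generated"
proof (intro equalityI span_minimal subspace_span)
  show "f ` {0<..<n} \<union> range c \<subseteq> span T" using assms(1,2) by auto
qed (rule assms(3))

context
  fixes p k :: nat
  assumes p: "prime p" and residue: "\<And>l. \<not> p dvd l \<Longrightarrow> of_nat l \<notin> M"
    and k: "p ^ k < n" "n \<le> p ^ Suc k"
begin

text \<open>In the cocycle relation with \<open>i = p ^ t\<close> the coefficient of
  \<open>f m\<close> is \<open>m choose p ^ t\<close>, which is prime to \<open>p\<close> and hence
  a unit.\<close>

lemma f_mem_span_power:
  assumes "p ^ t \<le> m" "m < p ^ Suc t" "m < n"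
  shows "f m \<in> span {f (p ^ t)}"
proof (cases "m = p ^ t")
  case True
  then show ?thesis by (simp add: span_base)
next
  case False
  have "of_nat (m choose p ^ t) *s f m = of_nat (n - p ^ t choose (m - p ^ t)) *s f (p ^ t)"
    using False assms p by (intro f_cocycle) (auto simp: prime_gt_0_nat)
  then show ?thesis
    using unit_scale_cancel[OF residue[OF not_dvd_choose_power[OF p assms(1,2)]]]
    by (metis insertI1 span_base span_scale)
qed

text \<open>If \<open>p ^ k + p ^ t \<le> n\<close>, symmetry replaces \<open>p ^ t\<close> by
  \<open>n - p ^ t\<close>, which lies between \<open>p ^ k\<close> and \<open>p ^ Suc k\<close>.
  Otherwise \<open>n - p ^ k < p ^ t\<close>, and the cocycle relation between
  \<open>f (p ^ t)\<close> and \<open>f (p ^ k)\<close> has a unit coefficient at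
  \<open>f (p ^ t)\<close>.\<close>

lemma f_power_mem_span:
  assumes "t \<le> k"
  shows "f (p ^ t) \<in> span {f (p ^ k)}"
proof -
  consider "t = k" | "t < k" "p ^ k + p ^ t \<le> n" | "t < k" "n < p ^ k + p ^ t"
    using assms by linarith
  then show ?thesis
  proof cases
    case 1
    then show ?thesis by (simp add: span_base)
  next
    case 2
    have pt: "0 < p ^ t" using p by (simp add: prime_gt_0_nat)
    then have "f (n - p ^ t) \<in> span {f (p ^ k)}"
      using 2 pt k by (intro f_mem_span_power[of k "n - p ^ t"]; linarith)
    moreover have "p ^ t < n" using 2 pt k by (cases "p ^ k") auto
    ultimately show ?thesis using f_symmetric pt by metis
  next
    case 3
    have pt: "0 < p ^ t" "p ^ t < p ^ k" 
      using prime_gt_0_nat[OF p] power_strict_increasing[OF 3(1) prime_gt_1_nat[OF p]] by simp_all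
    define r where "r = n - p ^ k"
    have r: "n = p ^ k + r" "r < p ^ t" using k 3 by (simp_all add: r_def)
    have "p ^ k = p ^ (k - t) * p ^ t"
      using 3(1) power_add[of p "k - t" t] by simp
    \<comment> \<open>As a multiple of \<open>p ^ t\<close>, this difference has the shape that
      \<open>not_dvd_choose_mod\<close> demands, with remainder \<open>r < p ^ t\<close>.\<close>
    then have u: "p ^ k - p ^ t = (p ^ (k - t) - 1) * p ^ t"
      by (metis diff_mult_distrib mult_1)
    have "n - p ^ t = (p ^ k - p ^ t) + r" using r(1) pt(2) by linarith
    then have "(n - p ^ t choose (p ^ k - p ^ t)) = ((p ^ k - p ^ t) + r choose r)"
      by (metis add_diff_cancel_left' binomial_symmetric le_add1)
    then have "\<not> p dvd (n - p ^ t choose (p ^ k - p ^ t))"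
      using not_dvd_choose_mod[OF p r(2)] u by metis
    moreover have "of_nat (p ^ k choose p ^ t) *s f (p ^ k) =
        of_nat (n - p ^ t choose (p ^ k - p ^ t)) *s f (p ^ t)"
      using pt k by (intro f_cocycle) auto
    ultimately show ?thesis
      using unit_scale_cancel[OF residue] by (metis insertI1 span_base span_scale)
  qed
qed

lemma f_mem_span:
  assumes "0 < m" "m < n"
  shows "f m \<in> span {f (p ^ k)}"
proof -
  obtain t where t: "p ^ t \<le> m" "m < p ^ Suc t"
    using ex_power_ivl1[of p m] p assms prime_ge_2_nat by auto
  then have "p ^ t < p ^ Suc k" using assms k by linarith
  then have "t < Suc k" using p by (metis power_less_imp_less_exp prime_gt_1_nat)
  then have "t \<le> k" by simp
  then have "span {f (p ^ t)} \<subseteq> span {f (p ^ k)}"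
    using f_power_mem_span by (intro span_minimal) auto
  then show ?thesis using f_mem_span_power[OF t assms(2)] by blast
qed

lemma cyclic_if_choose_unit:
  assumes i: "0 < i" "i < n" and unit: "of_nat (n choose i) \<notin> M"
  shows "span {f (p ^ k)} = generated"
proof (rule generated_eqI)
  show "c a \<in> span {f (p ^ k)}" for a
    using unit_scale_cancel[OF unit] c_f[OF i] f_mem_span[OF i] span_scale by metis
  show "{f (p ^ k)} \<subseteq> generated"
    using k p by (auto intro!: span_base simp: prime_gt_0_nat)
qed (rule f_mem_span)

end

text \<open>The unit can be cancelled in \<open>c_f\<close>, giving each \<open>f m\<close>, and in
  \<open>c_commute\<close>, giving each \<open>c b\<close>.\<close>

lemma cyclic_if_power_diff_unit:
  assumes "a ^ n - a \<notin> M"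
  shows "span {c a} = generated"
proof (rule generated_eqI)
  show "f m \<in> span {c a}" if "0 < m" "m < n" for m
    using unit_scale_cancel[OF assms] c_f[OF that, of a] by (metis insertI1 span_base span_scale)
  show "c b \<in> span {c a}" for b
    using unit_scale_cancel[OF assms] c_commute[of a b] by (metis insertI1 span_base span_scale)
  show "{c a} \<subseteq> generated" by (auto intro!: span_base)
qed

text \<open>On powers of a fixed element, \<open>c_mult\<close> becomes the Leibniz rule of a
  derivation, so this is the usual power rule.\<close>

lemma c_power:
  assumes "t ^ n = t"
  shows "c (t ^ Suc m) = (of_nat (Suc m) * t ^ m) *s c t"
proof (induction m)
  case (Suc m)
  have "c (t ^ Suc (Suc m)) = t *s c (t ^ Suc m) + (t ^ Suc m) ^ n *s c t"
    using c_mult[of t "t ^ Suc m"] by simp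
  also have "(t ^ Suc m) ^ n = t ^ Suc m"
    by (simp only: power_mult[symmetric] mult.commute[of _ n]) (simp only: power_mult assms)
  also have "t *s c (t ^ Suc m) + t ^ Suc m *s c t =
      (t * (of_nat (Suc m) * t ^ m) + t ^ Suc m) *s c t"
    by (simp only: Suc.IH scale_scale scale_left_distrib)
  also have "t * (of_nat (Suc m) * t ^ m) + t ^ Suc m = of_nat (Suc (Suc m)) * t ^ Suc m"
    by (simp add: algebra_simps)
  finally show ?case .
qed simp

lemma c_fixed_eq_0:
  assumes t: "t ^ n = t" and n_M: "of_nat n \<in> M"
  shows "c t = 0"
proof -
  have "c t = (of_nat n * t ^ (n - 1)) *s c t"
  proof -
    have "Suc (n - 1) = n" using n by simp
    then show ?thesis using c_power[OF t, of "n - 1"] t by metis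
  qed
  \<comment> \<open>The span of the empty set is the zero module, so cancelling a unit there yields
    \<open>c t = 0\<close>.\<close>
  then have "(1 - of_nat n * t ^ (n - 1)) *s c t \<in> span {}"
    by (simp add: scale_left_diff_distrib)
  moreover have "1 - of_nat n * t ^ (n - 1) \<notin> M"
    using n_M by (intro one_diff_notin mult_in')
  ultimately show ?thesis
    using unit_scale_cancel[of _ _ "{}"] by force
qed

text \<open>Since \<open>s ^ n - s = - (1 - s ^ (n - 1)) * s\<close>, and the first factor is a unit
  for \<open>s\<close> in \<open>M\<close>, \<open>c_commute\<close> can be solved for
  \<open>s *s c a\<close>.\<close>

lemma scale_c_mem_span:
  assumes s: "s \<in> M"
  shows "s *s c a \<in> span {c s}"
proof -
  have "(1 - s ^ (n - 1)) *s (s *s c a) = - ((a ^ n - a) *s c s)"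
  proof -
    have "s ^ n = s ^ (n - 1) * s" using n by (cases n) (simp_all add: mult.commute)
    then have "(1 - s ^ (n - 1)) * s = - (s ^ n - s)" by (simp add: algebra_simps)
    then show ?thesis using c_commute[of a s] by (simp add: scale_left_diff_distrib)
  qed
  moreover have "1 - s ^ (n - 1) \<notin> M"
    using s n by (intro one_diff_notin power_in) auto
  moreover have "- ((a ^ n - a) *s c s) \<in> span {c s}"
    by (intro span_neg span_scale span_base) simp
  ultimately show ?thesis
    using unit_scale_cancel by metis
qed

text \<open>By \<open>c_add\<close>, \<open>c\<close> is additive modulo the \<open>f i\<close>. A
  fixed lift \<open>t\<close> of \<open>a\<close> has \<open>c t = 0\<close>, which leaves
  \<open>c\<close> on \<open>M\<close>; there, induction over linear combinations of elements of
  \<open>S\<close> applies.\<close>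

lemma generated_by_residues:
  assumes lift: "\<And>a. \<exists>t. t ^ n = t \<and> t - a \<in> M" and n_M: "of_nat n \<in> M"
    and S: "ideal_gen S = M" and d: "0 < d" "d < n"
    and f: "\<And>m. 0 < m \<Longrightarrow> m < n \<Longrightarrow> f m \<in> span {f d}"
  shows "span ({f d} \<union> c ` S) = generated"
proof (rule generated_eqI)
  let ?T = "{f d} \<union> c ` S"
  show fT: "f m \<in> span ?T" if "0 < m" "m < n" for m
    using f[OF that] span_mono[of "{f d}" ?T] by blast
  have sum: "(\<Sum>i\<in>{0<..<n}. g i *s f i) \<in> span ?T" for g
    using fT by (auto intro!: span_sum span_scale)
  have c0: "c 0 = 0" using c_mult[of 0 0] n by (simp add: power_0_left)
  have cM: "c s \<in> span ?T" if "s \<in> M" for s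
  proof -
    have "s \<in> ideal_gen S" using that S by simp
    then show ?thesis
    proof (induction rule: module.span_induct_alt[OF module_times, consumes 1, case_names base step])
      case base
      then show ?case by (simp add: c0 span_zero)
    next
      case (step a x y)
      then have x: "x \<in> M" "c x \<in> span ?T" using S by (auto intro: module.span_base[OF module_times] span_base)
      have sub: "span {c x} \<subseteq> span ?T"
        using x by (intro span_minimal) auto
      \<comment> \<open>In \<open>c (a * x)\<close>, the term with the arbitrary \<open>c a\<close>
        is absorbed: one factor \<open>x\<close> already moves it into the span of
        \<open>c x\<close>.\<close>
      have "x ^ n *s c a = x ^ (n - 1) *s (x *s c a)"
        using n by (cases n) (simp_all add: mult.commute)
      then have "x ^ n *s c a \<in> span ?T"
        using scale_c_mem_span[OF x(1), of a] sub span_scale by (metis subsetD)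
      moreover have "c y \<in> span ?T" by (rule step)
      ultimately show ?case
        unfolding c_add c_mult using span_scale[OF x(2), of a] sum by (intro span_add)
    qed
  qed
  show "c a \<in> span ?T" for a
  proof -
    obtain t where t: "t ^ n = t" "t - a \<in> M" using lift by blast
    have "a - t \<in> M" using neg_in[OF t(2)] by simp
    then have "c (a - t) \<in> span ?T" by (rule cM)
    moreover have "c a = c (a - t) + c t + (\<Sum>i\<in>{0<..<n}. ((a - t) ^ i * t ^ (n - i)) *s f i)"
      using c_add[of "a - t" t] by simp
    ultimately show ?thesis
      using sum by (simp add: c_fixed_eq_0[OF t(1) n_M] span_add)
  qed
  show "?T \<subseteq> generated" using d by (auto intro!: span_base)
qed

end

subsection \<open>Finite fields in which \<open>x\<^sup>n = x\<close>\<close>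

text \<open>Modulo \<open>p ^ f - 1\<close>, \<open>p ^ h\<close> is congruent to
  \<open>p ^ b\<close> for \<open>b = h mod f\<close>. Hence \<open>p ^ f - 1\<close> divides the
  smaller number \<open>p ^ b - 1\<close>, which must be 0.\<close>

lemma power_minus_1_dvd:
  fixes p :: nat
  assumes p: "p \<ge> 2" and f: "f > 0" and dvd: "p ^ f - 1 dvd p ^ h - 1"
  shows "f dvd h"
proof -
  define b where "b = h mod f"
  have h: "h = f * (h div f) + b" by (simp add: b_def)
  have "int p ^ f - 1 dvd (int p ^ f) ^ (h div f) - 1"
    unfolding power_diff_1_eq by (rule dvd_triv_left)
  then have 1: "int p ^ f - 1 dvd int p ^ b * ((int p ^ f) ^ (h div f) - 1)" by simp
  have pos: "(1::nat) \<le> p ^ k" for k using p by simp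
  have "int (p ^ f - 1) dvd int (p ^ h - 1)" using dvd by (simp only: int_dvd_int_iff)
  then have "int p ^ f - 1 dvd int p ^ h - 1"
    by (simp only: of_nat_diff[OF pos] of_nat_power of_nat_1)
  moreover have "int p ^ h = int p ^ b * (int p ^ f) ^ (h div f)"
    by (subst h) (simp add: power_add power_mult mult.commute)
  then have "int p ^ h - 1 = int p ^ b * ((int p ^ f) ^ (h div f) - 1) + (int p ^ b - 1)"
    by (simp add: right_diff_distrib)
  ultimately have "int p ^ f - 1 dvd int p ^ b - 1"
    using dvd_add_right_iff[OF 1] by simp
  then have "p ^ f - 1 dvd p ^ b - 1"
    by (simp only: int_dvd_int_iff[symmetric] of_nat_diff[OF pos] of_nat_power of_nat_1)
  moreover have "p ^ b < p ^ f" using p f by (simp add: b_def)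
  ultimately have "p ^ b - 1 = 0"
    using pos[of b] by (meson diff_less_mono nat_dvd_not_less not_gr_zero)
  then have "b = 0"
    using p one_less_power[of p b] by (cases "b = 0") auto
  then show ?thesis by (simp add: b_def mod_eq_0_iff_dvd)
qed

text \<open>As \<open>p\<close> annihilates the additive group, its order is a power
  \<open>p ^ f\<close>. A generator of the cyclic multiplicative group has order
  \<open>p ^ f - 1\<close>, which divides \<open>p ^ h - 1\<close> by \<open>fixed\<close>, so
  \<open>f\<close> divides \<open>h\<close>.\<close>

lemma (in field) card_power_of_frobenius_fixed:
  assumes fin: "finite (carrier R)" and p: "prime p"
    and char: "\<And>x. x \<in> carrier R \<Longrightarrow> [p] \<cdot> x = \<zero>"
    and fixed: "\<And>x. x \<in> carrier R \<Longrightarrow> x [^] (p ^ h) = x" and h: "h > 0"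
  shows "\<exists>k\<ge>1. p ^ h = card (carrier R) ^ k"
proof -
  let ?q = "card (carrier R)"
  have q: "?q \<ge> 2"
    using card_mono[OF fin, of "{\<zero>, \<one>}"] by simp
  obtain f m where fm: "?q = p ^ f * m" "\<not> p dvd m"
  proof (rule multiplicity_decompose'[of ?q p])
    show "?q \<noteq> 0" "\<not> is_unit p" using p q by (auto simp: not_prime_unit)
  qed blast
  have "m = 1"
  proof (rule ccontr)
    assume "m \<noteq> 1"
    then obtain l where l: "prime l" "l dvd m" by (meson prime_factor_nat)
    have "l dvd ?q" unfolding fm(1) using l(2) by (rule dvd_mult)
    then obtain r where r: "?q = l ^ 1 * r" by (auto elim: dvdE)
    let ?ord = "group.ord (add_monoid R)"
    have ord: "Coset.order (add_monoid R) = l ^ 1 * r" using r by (simp add: Coset.order_def)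
    \<comment> \<open>Sylow's theorem with exponent 1 serves as Cauchy's theorem: a nonzero
      \<open>x\<close> in \<open>H\<close> has additive order dividing the coprime numbers
      \<open>p\<close> and \<open>l\<close>.\<close>
    then obtain H where H: "subgroup H (add_monoid R)" "card H = l ^ 1"
      using sylow_thm[OF l(1) a_group ord] fin by auto
    have "H \<noteq> {\<zero>}" using H(2) l(1) by auto
    then obtain x where x: "x \<in> H" "x \<noteq> \<zero>" using H subgroup.one_closed by fastforce
    then have xR: "x \<in> carrier R" using H(1) subgroup.mem_carrier by fastforce
    have "?ord x dvd p"
      using char[OF xR] xR group.pow_eq_id[OF a_group, of x p] by (simp add: add_pow_def)
    moreover have "?ord x dvd l"
    proof -
      interpret H: group "add_monoid R\<lparr>carrier := H\<rparr>"
        using group.subgroup_imp_group[OF a_group H(1)] by simp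
      have "x [^]\<^bsub>add_monoid R\<lparr>carrier := H\<rparr>\<^esub> l = \<zero>"
        using H.pow_order_eq_1[of x] x H(2) by (simp add: Coset.order_def)
      then have "x [^]\<^bsub>add_monoid R\<^esub> l = \<zero>"
        by (simp add: nat_pow_def)
      then show ?thesis using group.pow_eq_id[OF a_group, of x l] xR by simp
    qed
    moreover have "coprime p l"
      using fm(2) l(2) by (intro primes_coprime[OF p l(1)]) blast
    ultimately have "?ord x = 1" by (intro coprime_common_divisor_nat[of p l])
    then have "x = \<zero>" using group.pow_eq_id[OF a_group, of x 1] xR by simp
    then show False using x by simp
  qed
  then have qf: "?q = p ^ f" using fm by simp
  then have f: "f > 0" using q by (cases f) auto
  obtain g where g: "g \<in> carrier (mult_of R)"
    "carrier (mult_of R) = {g [^] i | i::nat. i \<in> UNIV}"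
    using finite_field_mult_group_has_gen[OF fin] by blast
  interpret M: group "mult_of R" by (rule field_mult_group)
  have fin': "finite (carrier (mult_of R))" using fin by simp
  have pow: "g [^]\<^bsub>mult_of R\<^esub> i = g [^] i" for i :: nat
    by (simp add: nat_pow_mult_of)
  have "M.ord g = card (carrier (mult_of R))"
    unfolding M.generate_pow_card[OF g(1)] M.generate_pow_on_finite_carrier[OF fin' g(1)] pow
    using g(2) by simp
  then have ord: "M.ord g = ?q - 1"
    using fin by (simp add: card_Diff_singleton)
  have gR: "g \<in> carrier R" "g \<noteq> \<zero>" using g(1) by auto
  have "Suc (p ^ h - 1) = p ^ h" using p by (simp add: prime_gt_0_nat)
  then have "g [^] (p ^ h - 1) \<otimes> g = \<one> \<otimes> g"
    using fixed[OF gR(1)] gR(1) nat_pow_Suc[of g "p ^ h - 1"] l_one by metis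
  then have "g [^] (p ^ h - 1) = \<one>"
    using gR m_rcancel[of g "g [^] (p ^ h - 1)" \<one>] by simp
  then have "?q - 1 dvd p ^ h - 1"
    using M.pow_eq_id[OF g(1), of "p ^ h - 1"] ord pow by simp
  then have "p ^ f - 1 dvd p ^ h - 1" unfolding qf .
  then have "f dvd h" by (rule power_minus_1_dvd[OF prime_ge_2_nat[OF p] f])
  then obtain k where "h = f * k" ..
  then have "p ^ h = ?q ^ k" "k \<ge> 1" using qf h by (auto simp: power_mult)
  then show ?thesis by blast
qed

subsection \<open>The residue field\<close>

context local_comm_ring
begin

text \<open>The usual root count over the residue field, phrased with representatives: dividing out
  one root leaves the others as roots because \<open>M\<close> is prime.\<close>

lemma degree_bounds_residue_roots:
  assumes "lead_coeff f = 1" and "finite B" and "\<And>b. b \<in> B \<Longrightarrow> poly f b \<in> M"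
    and "\<And>b b'. b \<in> B \<Longrightarrow> b' \<in> B \<Longrightarrow> b - b' \<in> M \<Longrightarrow> b = b'"
  shows "card B \<le> degree f"
  using assms
proof (induction "degree f" arbitrary: f B)
  case 0
  then have "f = [:1:]" by (metis degree_0_id lead_coeff_pCons(2) degree_eq_zeroE pCons_0_0)
  then have "B = {}" using 0(4) one_notin by auto
  then show ?case by simp
next
  case (Suc d)
  show ?case
  proof (cases "B = {}")
    case False
    then obtain b where b: "b \<in> B" by blast
    define g where "g = synthetic_div f b"
    have g: "degree g = d" using Suc(2) by (simp add: g_def degree_synthetic_div)
    have "coeff (f + smult b g) (Suc d) = coeff (pCons (poly f b) g) (Suc d)"
      unfolding g_def synthetic_div_correct ..
    then have lead: "lead_coeff g = 1"
      using Suc(3) g unfolding Suc(2)[symmetric] by (simp add: coeff_eq_0)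
    have "poly g c \<in> M" if c: "c \<in> B - {b}" for c
    proof -
      have "poly f c = poly ([:- b, 1:] * g + [:poly f b:]) c"
        unfolding g_def synthetic_div_correct' ..
      then have "(c - b) * poly g c = poly f c - poly f b" by (simp add: algebra_simps)
      then have "(c - b) * poly g c \<in> M"
        using diff_in[OF Suc(5) Suc(5)] b c by simp
      then show ?thesis using prime_M Suc(6) b c by blast
    qed
    then have "card (B - {b}) \<le> degree g"
      using g lead Suc(4,6) by (intro Suc(1)) auto
    then show ?thesis using g Suc(2,4) b by simp
  qed simp
qed

definition residue :: "'a \<Rightarrow> 'a set" where
  "residue a = {b. a - b \<in> M}"

lemma residue_eq_iff: "residue a = residue b \<longleftrightarrow> a - b \<in> M"
proof
  assume "residue a = residue b"
  then have "b \<in> residue a" by (simp add: residue_def zero_in)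
  then show "a - b \<in> M" by (simp add: residue_def)
next
  assume ab: "a - b \<in> M"
  have "a - c \<in> M \<longleftrightarrow> b - c \<in> M" for c
    using add_in[OF ab, of "b - c"] diff_in[OF _ ab, of "a - c"] by auto
  then show "residue a = residue b" by (simp add: residue_def)
qed

lemma residue_field_eq: "residue_field M = range residue"
  by (auto simp: residue_field_def quotient_def residue_def)

text \<open>Every residue class is a root of the monic polynomial \<open>X^n - X\<close>, so there
  are at most \<open>n\<close> classes.\<close>

lemma finite_residue_field:
  assumes n: "n \<ge> 2" and fixed: "\<And>a. a ^ n - a \<in> M"
  shows "finite (residue_field M)"
proof (rule ccontr)
  assume "infinite (residue_field M)"
  then obtain C where C: "C \<subseteq> residue_field M" "card C = Suc n" "finite C"
    using infinite_arbitrarily_large by blast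
  then obtain B where B: "C = residue ` B" "inj_on residue B"
    unfolding residue_field_eq by (metis subset_image_inj)
  let ?f = "monom 1 n - monom 1 1 :: 'a poly"
  have deg: "degree ?f = n"
    using n by (intro antisym degree_le le_degree) auto
  have "card B \<le> degree ?f"
  proof (rule degree_bounds_residue_roots)
    show "lead_coeff ?f = 1" unfolding deg using n by simp
    show "finite B" using B C by (metis finite_imageD)
    show "poly ?f b \<in> M" for b using fixed by (simp add: poly_monom)
    show "b = b'" if "b \<in> B" "b' \<in> B" "b - b' \<in> M" for b b'
      using that B(2) by (simp add: residue_eq_iff inj_on_eq_iff[symmetric])
  qed
  then show False using B C deg by (simp add: card_image)
qed

text \<open>Packaging the residue classes as a ring record makes Sylow's theorem and the cyclicity
  of finite multiplicative groups applicable. Operations use chosen representatives;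
  \<open>residue_ring_simps\<close> shows that the choice is immaterial.\<close>

definition residue_ring :: "'a set ring" where
  "residue_ring = \<lparr>carrier = residue_field M,
     monoid.mult = (\<lambda>X Y. residue ((SOME x. x \<in> X) * (SOME y. y \<in> Y))), one = residue 1,
     zero = residue 0, add = (\<lambda>X Y. residue ((SOME x. x \<in> X) + (SOME y. y \<in> Y)))\<rparr>"

lemma some_residue: "a - (SOME x. x \<in> residue a) \<in> M"
proof -
  have "a \<in> residue a" by (simp add: residue_def zero_in)
  then show ?thesis using someI[of "\<lambda>x. x \<in> residue a" a] by (simp add: residue_def)
qed

lemma residue_ring_simps:
  "carrier residue_ring = range residue"
  "residue a \<otimes>\<^bsub>residue_ring\<^esub> residue b = residue (a * b)"
  "residue a \<oplus>\<^bsub>residue_ring\<^esub> residue b = residue (a + b)"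
  "\<one>\<^bsub>residue_ring\<^esub> = residue 1" "\<zero>\<^bsub>residue_ring\<^esub> = residue 0"
proof -
  define x y where "x = (SOME x. x \<in> residue a)" and "y = (SOME x. x \<in> residue b)"
  have x: "a - x \<in> M" and y: "b - y \<in> M" by (simp_all add: x_def y_def some_residue)
  have "a * b - x * y = b * (a - x) + x * (b - y)" by (simp add: algebra_simps)
  then have "residue (a * b) = residue (x * y)"
    using add_in[OF mult_in[OF x] mult_in[OF y]] by (simp add: residue_eq_iff)
  then show "residue a \<otimes>\<^bsub>residue_ring\<^esub> residue b = residue (a * b)"
    by (simp add: residue_ring_def x_def y_def)
  have "a + b - (x + y) = (a - x) + (b - y)" by simp
  then have "residue (a + b) = residue (x + y)"
    unfolding residue_eq_iff using add_in[OF x y] by metis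
  then show "residue a \<oplus>\<^bsub>residue_ring\<^esub> residue b = residue (a + b)"
    by (simp add: residue_ring_def x_def y_def)
qed (simp_all add: residue_ring_def residue_field_eq)

lemma field_residue_ring: "field residue_ring"
proof -
  have "cring residue_ring"
  proof (rule cringI)
    show "abelian_group residue_ring"
    proof (rule abelian_groupI)
      fix x assume "x \<in> carrier residue_ring"
      then obtain a where a: "x = residue a" by (auto simp: residue_ring_simps)
      show "\<exists>y\<in>carrier residue_ring. y \<oplus>\<^bsub>residue_ring\<^esub> x = \<zero>\<^bsub>residue_ring\<^esub>"
        by (rule bexI[of _ "residue (- a)"]) (simp_all add: residue_ring_simps a)
    qed (auto simp: residue_ring_simps add_ac)
    show "comm_monoid residue_ring"
      by (rule comm_monoidI) (auto simp: residue_ring_simps mult_ac)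
  qed (auto simp: residue_ring_simps distrib_right)
  then show ?thesis
  proof (rule cring.cring_fieldI2)
    show "\<zero>\<^bsub>residue_ring\<^esub> \<noteq> \<one>\<^bsub>residue_ring\<^esub>"
      using one_notin neg_in[of "- 1"] by (auto simp: residue_ring_simps residue_eq_iff)
    fix x assume x: "x \<in> carrier residue_ring" "x \<noteq> \<zero>\<^bsub>residue_ring\<^esub>"
    then obtain a where "x = residue a" by (auto simp: residue_ring_simps)
    moreover from this x have "a \<notin> M" by (simp add: residue_ring_simps residue_eq_iff)
    ultimately have a: "x = residue a" "a \<notin> M" by auto
    then obtain b where "b * a = 1" using local_ring_unit[OF local] by blast
    then show "\<exists>b\<in>carrier residue_ring. x \<otimes>\<^bsub>residue_ring\<^esub> b = \<one>\<^bsub>residue_ring\<^esub>"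
      by (intro bexI[of _ "residue b"]) (simp_all add: residue_ring_simps a mult.commute)
  qed
qed

lemma card_residue_field:
  assumes p: "prime p" "of_nat p \<in> M" and h: "h > 0"
    and fixed: "\<And>a. a ^ (p ^ h) - a \<in> M"
  shows "finite (residue_field M)" and "\<exists>k\<ge>1. p ^ h = card (residue_field M) ^ k"
proof -
  have "p ^ h \<ge> 2"
    using p h by (metis One_nat_def Suc_leI one_less_power prime_gt_1_nat Suc_1)
  then show fin: "finite (residue_field M)"
    using fixed by (rule finite_residue_field)
  interpret K: field residue_ring by (rule field_residue_ring)
  have carrier: "carrier residue_ring = residue_field M"
    by (simp add: residue_ring_def)
  have pow: "residue a [^]\<^bsub>residue_ring\<^esub> k = residue (a ^ k)" for a and k :: nat
    by (induction k) (simp_all add: residue_ring_simps mult.commute)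
  have mult: "[k] \<cdot>\<^bsub>residue_ring\<^esub> residue a = residue (of_nat k * a)" for a and k :: nat
    by (induction k) (simp_all add: residue_ring_simps K.add.nat_pow_Suc algebra_simps)
  have "\<exists>k\<ge>1. p ^ h = card (carrier residue_ring) ^ k"
  proof (rule K.card_power_of_frobenius_fixed[OF _ p(1) _ _ h])
    show "finite (carrier residue_ring)" using fin carrier by simp
    fix x assume "x \<in> carrier residue_ring"
    then obtain a where a: "x = residue a" by (auto simp: residue_ring_simps)
    show "[p] \<cdot>\<^bsub>residue_ring\<^esub> x = \<zero>\<^bsub>residue_ring\<^esub>"
      using mult_in'[OF p(2)] by (simp add: a mult residue_ring_simps residue_eq_iff)
    show "x [^]\<^bsub>residue_ring\<^esub> (p ^ h) = x"
      using fixed by (simp add: a pow residue_eq_iff)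
  qed
  then show "\<exists>k\<ge>1. p ^ h = card (residue_field M) ^ k" by (simp add: carrier)
qed

end

section \<open>From the relations to the bounds on the number of generators\<close>

lemma ring_hom_of_nat: "is_ring_hom h \<Longrightarrow> h (of_nat k) = of_nat k"
  by (induction k) (simp_all add: Defs.ring_hom_0 Defs.ring_hom_1 Defs.ring_hom_add)

lemma drinfeld_module_indec:
  fixes M :: "'a::comm_ring_1 set"
  assumes M: "local_ring M" and n: "n \<ge> 2"
  shows "drinfeld_module M indec_scale n (\<lambda>i. indec_F $ i $ (n - i)) (\<lambda>a. indec_rho a $ n)"
proof -
  note hom = is_ring_hom_indec_of[where 'a = 'a]
  note hom_simps = indec_scale_eq ring_hom_of_nat[OF hom] Defs.ring_hom_power[OF hom]
    Defs.ring_hom_mult[OF hom] Defs.ring_hom_diff[OF hom]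
  show ?thesis
  proof
    show "local_ring M" by (rule M)
    show "n \<ge> 2" by (rule n)
    show "indec_F $ (n - i) $ (n - (n - i)) = (indec_F :: 'a lazard_indec fps2) $ i $ (n - i)"
      if "0 < i" "i < n" for i
      using that by (subst indec.F_commute) simp
    show "indec_scale (of_nat (m choose i)) (indec_F $ m $ (n - m)) =
        indec_scale (of_nat (n - i choose (m - i))) ((indec_F :: 'a lazard_indec fps2) $ i $ (n - i))"
      if "0 < i" "i < m" "m < n" for i m
      using that indec.F_cocycle[of i "m - i" "n - m"] by (simp add: hom_simps)
    show "indec_scale (of_nat (n choose i)) (indec_rho a $ n) =
        indec_scale (a ^ n - a) (indec_F $ i $ (n - i))" if "0 < i" "i < n" for i and a :: 'a
    proof -
      have "of_nat (n choose i) * indec_rho a $ n =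
          indec_of a ^ n * indec_F $ i $ (n - i) - indec_of a * indec_F $ i $ (n - i)"
        using that indec.rho_endo[of i "n - i" a] by (simp add: algebra_simps)
      then show ?thesis by (simp add: hom_simps left_diff_distrib)
    qed
    show "indec_rho (a + b) $ n = indec_rho a $ n + indec_rho b $ n +
        (\<Sum>i\<in>{0<..<n}. indec_scale (a ^ i * b ^ (n - i)) (indec_F $ i $ (n - i)))" for a b :: 'a
      using indec.rho_add[OF n, of a b] by (simp add: hom_simps)
    show "indec_rho (a * b) $ n = indec_scale a (indec_rho b $ n) + indec_scale (b ^ n) (indec_rho a $ n)"
      for a b :: 'a
      using indec.rho_mult[OF n, of a b] by (simp add: hom_simps)
  qed
qed

text \<open>Apply the Henselian property to \<open>X^n - X\<close>: its derivative at
  \<open>a\<close> is \<open>n * a ^ (n - 1) - 1\<close>, a unit because \<open>n\<close> lies in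
  \<open>M\<close>.\<close>

lemma henselian_lift_power_fixed:
  fixes a :: "'a::comm_ring_1"
  assumes M: "henselian_local_ring M" and n: "n \<ge> 2" "of_nat n \<in> M" and a: "a ^ n - a \<in> M"
  shows "\<exists>t. t ^ n = t \<and> t - a \<in> M"
proof -
  interpret local_comm_ring M
    using M by unfold_locales (simp add: henselian_local_ring_def)
  let ?f = "monom 1 n - monom 1 1 :: 'a poly"
  have deg: "degree ?f = n"
    using n by (intro antisym degree_le le_degree) auto
  have "poly (poly_deriv ?f) a = (\<Sum>i\<le>n. of_nat i * coeff ?f i * a ^ (i - 1))"
    unfolding poly_deriv_def deg by (simp add: poly_sum poly_monom)
  also have "\<dots> = (\<Sum>i\<in>{1, n}. of_nat i * coeff ?f i * a ^ (i - 1))"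
    using n by (intro sum.mono_neutral_right) auto
  also have "\<dots> = of_nat n * a ^ (n - 1) - 1"
    using n by simp
  finally have "poly (poly_deriv ?f) a = - (1 - of_nat n * a ^ (n - 1))" by simp
  then have "poly (poly_deriv ?f) a \<notin> M"
    using one_diff_notin[OF mult_in'[OF n(2)]] neg_in by (metis minus_minus)
  moreover have "lead_coeff ?f = 1" unfolding deg using n by simp
  moreover have "poly ?f a \<in> M" using a by (simp add: poly_monom)
  ultimately obtain t where "poly ?f t = 0" "t - a \<in> M"
    using M unfolding henselian_local_ring_def by blast
  then show ?thesis by (auto simp: poly_monom)
qed

lemma card_ordLeq_csum_one:
  assumes "|S| \<le>o \<kappa>" "Card_order \<kappa>"
  shows "|{x} \<union> g ` S| \<le>o cone +c \<kappa>"
proof -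
  have "|{x} \<union> g ` S| \<le>o |{x}| +c |g ` S|"
    by (rule Un_csum)
  also have "|{x}| +c |g ` S| \<le>o cone +c \<kappa>"
  proof (rule csum_mono)
    show "|{x}| \<le>o cone"
      unfolding cone_def by (rule card_of_ordLeqI[of "\<lambda>_. ()"]) auto
    show "|g ` S| \<le>o \<kappa>"
      using card_of_image assms(1) by (rule ordLeq_transitive)
  qed
  finally show ?thesis .
qed

theorem proposition2p8:
  fixes M :: "'a::comm_ring_1 set"
    and \<kappa> :: "'k rel"
    and n :: nat
  assumes "henselian_local_ring M"
    and "\<And>(k::nat) (a::'a). k > 0 \<Longrightarrow> of_nat k * a = 0 \<Longrightarrow> a = 0"
    and "Card_order \<kappa>"
    and "\<exists>S. |S| \<le>o \<kappa> \<and> ideal_gen S = M"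
    and "n \<ge> 1"
  shows "if \<exists>q k. finite (residue_field M) \<and> card (residue_field M) = q \<and> k \<ge> 1 \<and> n = q ^ k
         then \<exists>T. |T| \<le>o cone +c \<kappa> \<and>
                module.span indec_scale T = (indec_degree (2 * n - 2) :: 'a lazard_indec set)
         else \<exists>t. module.span indec_scale {t} = (indec_degree (2 * n - 2) :: 'a lazard_indec set)"
proof -
  let ?N = "indec_degree (2 * n - 2) :: 'a lazard_indec set"
  let ?span = "module.span indec_scale :: 'a lazard_indec set \<Rightarrow> _"
  have local: "local_ring M" using assms(1) by (simp add: henselian_local_ring_def)
  \<comment> \<open>A single generator suffices for either branch, as \<open>1\<close> is at most
    \<open>1 + \<kappa>\<close>; cyclic cases therefore never have to decide the condition on the
    residue field.\<close>
  have cyclic: ?thesis if "?span {t} = ?N" for t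
  proof -
    have "|{t} \<union> (\<lambda>_. t) ` {}| \<le>o cone +c \<kappa>"
      using card_of_empty1 assms(3) by (intro card_ordLeq_csum_one) (auto intro: card_of_empty1)
    then show ?thesis using that by auto
  qed
  show ?thesis
  proof (cases "n = 1")
    case True
    then show ?thesis by (intro cyclic[of 1]) (simp add: indec_degree_0)
  next
    case False
    then have n: "n \<ge> 2" using assms(5) by simp
    let ?f = "\<lambda>i. (indec_F :: 'a lazard_indec fps2) $ i $ (n - i)"
    interpret drinfeld_module M indec_scale n ?f "\<lambda>a. indec_rho a $ n"
      by (rule drinfeld_module_indec[OF local n])
    have N: "?N = generated" by (rule indec_degree_eq_span[OF n])
    obtain p :: nat where p: "prime p" "\<And>l. \<not> p dvd l \<Longrightarrow> of_nat l \<notin> M"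
      using residue_prime by blast
    obtain k where k: "p ^ k < n" "n \<le> p ^ Suc k"
      using ex_power_ivl2[of p n] prime_ge_2_nat[OF p(1)] n by auto
    have pk: "p ^ k > 0" using p by (simp add: prime_gt_0_nat)
    \<comment> \<open>The first two cases provide a unit among the binomial coefficients of
      \<open>n\<close>, the third a unit \<open>a ^ n - a\<close>; in the last, the residue field is
      finite and \<open>n\<close> is a power of its order.\<close>
    consider "n < p ^ Suc k" | "n = p ^ Suc k" "of_nat p \<notin> M"
      | a where "a ^ n - a \<notin> M"
      | "n = p ^ Suc k" "of_nat p \<in> M" "\<And>a. a ^ n - a \<in> M"
      using le_neq_implies_less[OF k(2)] by blast
    then show ?thesis
    proof cases
      case 1
      then have unit: "of_nat (n choose p ^ k) \<notin> M"
        using k by (intro p not_dvd_choose_power) auto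
      have "?span {?f (p ^ k)} = ?N"
        unfolding N by (rule cyclic_if_choose_unit[OF p(1) _ k pk k(1) unit], rule p(2))
      then show ?thesis by (rule cyclic)
    next
      case 2
      have "of_nat p ^ m \<notin> M" for m
        using one_notin prime_M 2(2) by (induction m) (auto simp only: power_0 power_Suc)
      then have unit: "of_nat (n choose 1) \<notin> M"
        unfolding 2(1) by (simp only: choose_one of_nat_power not_False_eq_True)
      have "1 < n" using n by simp
      then have "?span {?f (p ^ k)} = ?N"
        unfolding N by (intro cyclic_if_choose_unit[OF p(1) _ k zero_less_one _ unit]) (rule p(2))
      then show ?thesis by (rule cyclic)
    next
      case 3
      then have "?span {indec_rho a $ n} = ?N"
        unfolding N by (rule cyclic_if_power_diff_unit)
      then show ?thesis by (rule cyclic)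
    next
      case 4
      have nM: "of_nat n \<in> M"
        unfolding 4(1) of_nat_power using 4(2) by (rule power_in) simp
      note residue_field = card_residue_field[OF p(1) 4(2) zero_less_Suc 4(3)[unfolded 4(1)]]
      then obtain l where "l \<ge> 1" "n = card (residue_field M) ^ l"
        unfolding 4(1)[symmetric] by blast
      then have if_cond: "\<exists>q l. finite (residue_field M) \<and> card (residue_field M) = q \<and> l \<ge> 1 \<and> n = q ^ l"
        using residue_field(1) by (intro exI[of _ "card (residue_field M)"] exI[of _ l]) simp
      obtain S where S: "|S| \<le>o \<kappa>" "ideal_gen S = M" using assms(4) by blast
      have "?span ({?f (p ^ k)} \<union> (\<lambda>a. indec_rho a $ n) ` S) = ?N"
        unfolding N
      proof (rule generated_by_residues[OF _ nM S(2) pk k(1)])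
        show "\<exists>t. t ^ n = t \<and> t - a \<in> M" for a
          using henselian_lift_power_fixed[OF assms(1) n nM 4(3)] .
        show "?f m \<in> ?span {?f (p ^ k)}" if "0 < m" "m < n" for m
          by (rule f_mem_span[OF p(1) _ k that], rule p(2))
      qed
      with card_ordLeq_csum_one[OF S(1) assms(3)] show ?thesis
        unfolding if_P[OF if_cond] by (intro exI conjI)
    qed
  qed
qed

end
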